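(* Let $p$ be a prime, $\psi$ an additive unitary character of $\mathbb Q_p$ with conductor $\mathbb Z_p$, and $m\ge1$. Let $L=\mathbb Z_p^{4m}$ with quadratic form $q(x_1,\dots,x_{2m},y_1,\dots,y_{2m})=\sum_{i=1}^mx_iy_i+p\sum_{i=m+1}^{2m}x_iy_i$ and associated bilinear form $(x,y)=q(x+y)-q(x)-q(y)$. For an integer $r\ge0$ and $\eta\in L\otimes\mathbb Q_p$ with $q(\eta)\neq0$ put $$C_{r,\eta}=\int_{x\in p^{-r}L}\psi((\eta,x))\,\mathrm{Char}(p^rq(x)\in\mathbb Z_p)\,dx$$ (Haar measure with $\mathrm{vol}(L)=1$). Write $\eta=(a_1,\dots,a_{2m},b_1,\dots,b_{2m})$, $\eta_1=(a_1,\dots,a_m,b_1,\dots,b_m)$, $\eta_2=(a_{m+1},\dots,a_{2m},b_{m+1},\dots,b_{2m})$, let $v_p$ of a vector be the minimum of the $p$-adic valuations of its coordinates, and set $k_1=\min(v_p(\eta_1),v_p(\eta_2))$, $k_2=\min(v_p(\eta_1),v_p(\eta_2)+1)$, $k=v_p(q(\eta))$, $k'=k-k_1-k_2$. Then: the series $\sum_{r\ge0}p^{-rs}C_{r,\eta}$ is nonzero only if $k_2\ge0$; if $k_2=0$ and $k_1=-1$ it equals $1$; and if $k_2\ge k_1\ge0$ (i.e. $\eta\in L$), $$\sum_{r\ge0}p^{-rs}C_{r,\eta}=(1-p^{2m-s-1})R_{\eta,p}(p^{2m-s})+\sum_{r=0}^{k_2}p^{r(4m-s-1)}-p^{3m-s-1}\sum_{r=0}^{k_1}p^{r(4m-s-1)},$$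 where $$R_{\eta,p}(X)=p^m\Big(\sum_{r=1}^{k_2}\frac{p^{r(2m-1)}-1}{p^{2m-1}-1}X^r+\frac{p^{(k_1+1)(2m-1)}-1}{p^{2m-1}-1}\sum_{r=k_2+1}^{k_2+k'}X^r+\sum_{r=k_2+k'+1}^{k}\frac{p^{(k-r+1)(2m-1)}-1}{p^{2m-1}-1}X^r\Big)$$ is a polynomial in $\mathbb Z[X]$ of degree $k$ satisfying $X^{k+1}R_{\eta,p}(X^{-1})=R_{\eta,p}(X)$. *)

theory Defs
  imports
    "HOL-Analysis.Analysis"
    "HOL-Computational_Algebra.Fraction_Field"
    "HOL-Library.Extended"
    "Berlekamp_Zassenhaus.Finite_Field"
begin

no_notation Pinf (\<open>\<infinity>\<close>) and Minf (\<open>-\<infinity>\<close>)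
hide_const (open) Module.smult UnivPoly.monom UnivPoly.coeff Order.top Order.bottom

section \<open>The ring of \<open>p\<close>-adic integers\<close>

text \<open>Types cannot depend on the number \<open>p\<close>; the prime is therefore carried by a type \<open>'p\<close>
  of class \<^class>\<open>prime_card\<close>, with \<open>p = CARD('p)\<close>.
  A \<open>p\<close>-adic integer is a compatible system of residues \<open>f n \<in> {0..<p^n}\<close>; the case \<open>m = n\<close>
  below says that \<open>f n\<close> is a reduced residue.\<close>

typedef 'p padic_int =
  "{f :: nat \<Rightarrow> int. \<forall>m n. m \<le> n \<longrightarrow> f n mod int CARD('p::prime_card) ^ m = f m}"
  morphisms residue Abs_padic_int
  by (rule exI[of _ "\<lambda>_. 0"]) simp

setup_lifting type_definition_padic_int

lemma mod_pow_pow: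
  fixes a p :: int
  assumes "m \<le> n" shows "a mod p ^ n mod p ^ m = a mod p ^ m"
  using assms by (simp add: mod_mod_cancel le_imp_power_dvd)

instantiation padic_int :: (prime_card) comm_ring_1
begin

lift_definition zero_padic_int :: "'a padic_int" is "\<lambda>_. 0" by simp
lift_definition one_padic_int :: "'a padic_int" is "\<lambda>n. 1 mod int CARD('a) ^ n"
  by (simp add: mod_pow_pow)
lift_definition plus_padic_int :: "'a padic_int \<Rightarrow> 'a padic_int \<Rightarrow> 'a padic_int"
  is "\<lambda>f g n. (f n + g n) mod int CARD('a) ^ n"
  by (simp add: mod_pow_pow) (metis mod_add_eq)
lift_definition times_padic_int :: "'a padic_int \<Rightarrow> 'a padic_int \<Rightarrow> 'a padic_int"
  is "\<lambda>f g n. (f n * g n) mod int CARD('a) ^ n"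
  by (simp add: mod_pow_pow) (metis mod_mult_eq)
lift_definition uminus_padic_int :: "'a padic_int \<Rightarrow> 'a padic_int"
  is "\<lambda>f n. (- f n) mod int CARD('a) ^ n"
  by (simp add: mod_pow_pow) (metis mod_minus_eq)
lift_definition minus_padic_int :: "'a padic_int \<Rightarrow> 'a padic_int \<Rightarrow> 'a padic_int"
  is "\<lambda>f g n. (f n - g n) mod int CARD('a) ^ n"
  by (simp add: mod_pow_pow) (metis mod_diff_eq)

instance
proof
  fix a b c :: "'a padic_int"
  show "a + b + c = a + (b + c)"
    by transfer (simp add: fun_eq_iff mod_simps add.assoc)
  show "a + b = b + a"
    by transfer (simp add: add.commute)
  show "0 + a = a"
    by transfer simp
  show "- a + a = 0"
    by transfer (simp add: fun_eq_iff mod_simps)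
  show "a - b = a + - b"
    by transfer (simp add: fun_eq_iff mod_simps)
  show "a * b * c = a * (b * c)"
    by transfer (simp add: fun_eq_iff mod_simps mult.assoc)
  show "a * b = b * a"
    by transfer (simp add: mult.commute)
  show "1 * a = a"
    by transfer (simp add: fun_eq_iff mod_simps)
  show "(a + b) * c = a * c + b * c"
    by transfer (simp add: fun_eq_iff mod_simps distrib_right)
  show "(0 :: 'a padic_int) \<noteq> 1"
  proof transfer
    have "prime CARD('a)" by (rule prime_card)
    then have "int CARD('a) > 1" by (metis of_nat_1 of_nat_less_iff prime_gt_1_nat)
    then show "(\<lambda>_. 0) \<noteq> (\<lambda>n. 1 mod int CARD('a) ^ n)"
      by (auto simp: fun_eq_iff intro!: exI[of _ 1])
  qed
qed

end

definition padic_int_val :: "'p::prime_card padic_int \<Rightarrow> nat" where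
  "padic_int_val x = (LEAST n. residue x (Suc n) \<noteq> 0)"

lemma residue_mod: "m \<le> n \<Longrightarrow> residue (x :: 'p::prime_card padic_int) n mod int CARD('p) ^ m = residue x m"
  by transfer simp

lemma residue_zero_mono:
  assumes "residue (x :: 'p::prime_card padic_int) n = 0" "m \<le> n"
  shows "residue x m = 0"
  using residue_mod[OF assms(2), of x] assms(1) by simp

lemma residue_0: "residue (x :: 'p::prime_card padic_int) 0 = 0"
  using residue_mod[of 0 0 x] by simp

lemma padic_int_val_iff:
  assumes "(x :: 'p::prime_card padic_int) \<noteq> 0"
  shows "n \<le> padic_int_val x \<longleftrightarrow> residue x n = 0"
proof -
  obtain j where j: "residue x j \<noteq> 0"
    using assms by transfer (auto simp: fun_eq_iff)
  then obtain i where "j = Suc i"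
    using residue_0[of x] by (cases j) auto
  with j have L: "residue x (Suc (padic_int_val x)) \<noteq> 0"
    unfolding padic_int_val_def by (metis (mono_tags, lifting) LeastI)
  show ?thesis
  proof
    assume le: "n \<le> padic_int_val x"
    show "residue x n = 0"
    proof (cases n)
      case 0
      then show ?thesis by (simp add: residue_0)
    next
      case (Suc i)
      with le have "i < (LEAST n. residue x (Suc n) \<noteq> 0)"
        by (simp add: padic_int_val_def)
      from not_less_Least[OF this] Suc show ?thesis by simp
    qed
  next
    assume "residue x n = 0"
    with L show "n \<le> padic_int_val x"
      by (meson not_less_eq_eq residue_zero_mono)
  qed
qed

lemma padic_int_val_mult_aux:
  fixes x y :: "'p::prime_card padic_int"
  assumes x: "x \<noteq> 0" and y: "y \<noteq> 0"
  shows "x * y \<noteq> 0 \<and> padic_int_val (x * y) = padic_int_val x + padic_int_val y"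
proof -
  define p where "p = int CARD('p)"
  have p: "prime p"
    unfolding p_def by (rule prime_card_int)
  define v w N where "v = padic_int_val x" and "w = padic_int_val y" and "N = Suc (v + w)"
  have res: "residue (x * y) n = residue x n * residue y n mod p ^ n" for n
    unfolding p_def by transfer simp
  have mult: "p ^ u dvd residue z N \<and> \<not> p ^ Suc u dvd residue z N"
    if "z \<noteq> 0" "u = padic_int_val z" "u \<le> v + w" for u and z :: "'p padic_int"
  proof -
    have "residue z u = 0" "residue z (Suc u) \<noteq> 0"
      using padic_int_val_iff[OF that(1), of u] padic_int_val_iff[OF that(1), of "Suc u"] that(2)
      by auto
    moreover have "residue z N mod p ^ u = residue z u" "residue z N mod p ^ Suc u = residue z (Suc u)"
      unfolding p_def using that(3) by (intro residue_mod; simp add: N_def)+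
    ultimately show ?thesis
      by (simp add: dvd_eq_mod_eq_0)
  qed
  obtain a where a: "residue x N = p ^ v * a" and na: "\<not> p dvd a"
    using mult[OF x v_def] by (auto elim!: dvdE)
  obtain b where b: "residue y N = p ^ w * b" and nb: "\<not> p dvd b"
    using mult[OF y w_def] by (auto elim!: dvdE)
  have "\<not> p dvd a * b"
    using p na nb by (simp add: prime_dvd_mult_iff)
  moreover have eq: "residue x N * residue y N = p ^ (v + w) * (a * b)"
    by (simp add: a b power_add)
  moreover have "p \<noteq> 0"
    using p by auto
  ultimately have nd: "\<not> p ^ N dvd residue x N * residue y N"
    by (simp add: N_def)
  then have N: "residue (x * y) N \<noteq> 0"
    by (simp add: res dvd_eq_mod_eq_0)
  then have nz: "x * y \<noteq> 0"
    by (metis residue_zero_mono zero_padic_int.rep_eq)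
  have "residue (x * y) (v + w) = residue (x * y) N mod p ^ (v + w)"
    unfolding p_def by (rule residue_mod[symmetric]) (simp add: N_def)
  also have "\<dots> = 0"
    unfolding res eq by (simp add: mod_pow_pow N_def del: power_Suc)
  finally have "residue (x * y) (v + w) = 0" .
  with N nz show ?thesis
    using padic_int_val_iff[OF nz, of "v + w"] padic_int_val_iff[OF nz, of N]
    by (auto simp: v_def w_def N_def)
qed

instance padic_int :: (prime_card) idom
  by standard (simp add: padic_int_val_mult_aux)

lemma padic_int_val_mult:
  "x \<noteq> 0 \<Longrightarrow> y \<noteq> 0 \<Longrightarrow> padic_int_val (x * y) = padic_int_val x + padic_int_val y"
  by (simp add: padic_int_val_mult_aux)

lemma padic_int_val_add:
  assumes "x \<noteq> 0" "y \<noteq> 0" "x + y \<noteq> 0"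
  shows "min (padic_int_val x) (padic_int_val y) \<le> padic_int_val (x + y)"
proof -
  let ?n = "min (padic_int_val x) (padic_int_val y)"
  have "residue x ?n = 0" "residue y ?n = 0"
    using padic_int_val_iff[OF assms(1), of ?n] padic_int_val_iff[OF assms(2), of ?n] by auto
  then have "residue (x + y) ?n = 0"
    by (simp add: plus_padic_int.rep_eq)
  then show ?thesis
    using padic_int_val_iff[OF assms(3)] by blast
qed


section \<open>The field of \<open>p\<close>-adic numbers\<close>

text \<open>A copy of the fraction field of the \<open>p\<close>-adic integers, so that it can carry the
  \<open>p\<close>-adic topology.\<close>

typedef 'p padic = "UNIV :: 'p::prime_card padic_int fract set" ..

lifting_forget padic_int.lifting
setup_lifting type_definition_padic

instantiation padic :: (prime_card) field
begin

lift_definition zero_padic :: "'a padic" is 0 .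
lift_definition one_padic :: "'a padic" is 1 .
lift_definition plus_padic :: "'a padic \<Rightarrow> 'a padic \<Rightarrow> 'a padic" is "(+)" .
lift_definition minus_padic :: "'a padic \<Rightarrow> 'a padic \<Rightarrow> 'a padic" is "(-)" .
lift_definition uminus_padic :: "'a padic \<Rightarrow> 'a padic" is "uminus" .
lift_definition times_padic :: "'a padic \<Rightarrow> 'a padic \<Rightarrow> 'a padic" is "(*)" .
lift_definition divide_padic :: "'a padic \<Rightarrow> 'a padic \<Rightarrow> 'a padic" is "(/)" .
lift_definition inverse_padic :: "'a padic \<Rightarrow> 'a padic" is "inverse" .

instance
proof
  fix a b c :: "'a padic"
  show "a * b * c = a * (b * c)" by transfer (rule mult.assoc)
  show "a * b = b * a" by transfer (rule mult.commute)
  show "1 * a = a" by transfer (rule mult_1)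
  show "a + b + c = a + (b + c)" by transfer (rule add.assoc)
  show "a + b = b + a" by transfer (rule add.commute)
  show "0 + a = a" by transfer (rule add_0)
  show "- a + a = 0" by transfer (rule left_minus)
  show "a - b = a + - b" by transfer (rule diff_conv_add_uminus)
  show "(a + b) * c = a * c + b * c" by transfer (rule distrib_right)
  show "(0 :: 'a padic) \<noteq> 1" by transfer (rule zero_neq_one)
  show "a \<noteq> 0 \<Longrightarrow> inverse a * a = 1" by transfer (rule left_inverse)
  show "a div b = a * inverse b" by transfer (rule divide_inverse)
  show "inverse (0 :: 'a padic) = 0" by transfer (rule inverse_zero)
qed

end

lift_definition padic_of_int :: "'p::prime_card padic_int \<Rightarrow> 'p padic" is "\<lambda>a. Fract a 1" .

definition padic_Ints :: "'p::prime_card padic set" where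
  "padic_Ints = range padic_of_int"

text \<open>The valuation, normalised by \<open>v(p) = 1\<close> and \<open>v(0) = \<infinity>\<close>.\<close>

definition padic_val :: "'p::prime_card padic \<Rightarrow> int extended" where
  "padic_val x = (if x = 0 then Pinf else Fin (THE k. \<exists>a b. a \<noteq> 0 \<and> b \<noteq> 0 \<and>
     x = padic_of_int a / padic_of_int b \<and> k = int (padic_int_val a) - int (padic_int_val b)))"

lemma padic_of_int_eq_0_iff [simp]: "padic_of_int a = 0 \<longleftrightarrow> a = 0"
  by transfer (simp add: Zero_fract_def eq_fract)

lemma padic_of_int_eq_iff [simp]: "padic_of_int a = padic_of_int b \<longleftrightarrow> a = b"
  by transfer (simp add: eq_fract)

lemma padic_of_int_mult: "padic_of_int (a * b) = padic_of_int a * padic_of_int b"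
  by transfer simp

lemma padic_of_int_add: "padic_of_int (a + b) = padic_of_int a + padic_of_int b"
  by transfer simp

lemma padic_of_int_minus: "padic_of_int (- a) = - padic_of_int a"
  by transfer simp

lemma padic_of_int_1: "padic_of_int 1 = 1"
  by transfer (simp add: One_fract_def)

lemma padic_cases:
  obtains a b where "b \<noteq> 0" "x = padic_of_int a / padic_of_int b"
proof -
  have "\<exists>a b. b \<noteq> 0 \<and> x = padic_of_int a / padic_of_int b"
  proof transfer
    fix x :: "'a padic_int fract"
    show "\<exists>a b. b \<noteq> 0 \<and> x = Fract a 1 / Fract b 1"
      by (cases x) auto
  qed
  then show ?thesis using that by blast
qed

lemma padic_val_0 [simp]: "padic_val 0 = Pinf"
  by (simp add: padic_val_def)

lemma padic_val_quot:
  assumes a: "a \<noteq> 0" and b: "b \<noteq> 0"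
  shows "padic_val (padic_of_int a / padic_of_int b) =
    Fin (int (padic_int_val a) - int (padic_int_val b))"
proof -
  have "(THE k. \<exists>c d. c \<noteq> 0 \<and> d \<noteq> 0 \<and> padic_of_int a / padic_of_int b = padic_of_int c / padic_of_int d \<and>
      k = int (padic_int_val c) - int (padic_int_val d)) = int (padic_int_val a) - int (padic_int_val b)"
  proof (rule the_equality)
    show "\<exists>c d. c \<noteq> 0 \<and> d \<noteq> 0 \<and> padic_of_int a / padic_of_int b = padic_of_int c / padic_of_int d \<and>
      int (padic_int_val a) - int (padic_int_val b) = int (padic_int_val c) - int (padic_int_val d)"
      using a b by blast
  next
    fix k
    assume "\<exists>c d. c \<noteq> 0 \<and> d \<noteq> 0 \<and> padic_of_int a / padic_of_int b = padic_of_int c / padic_of_int d \<and>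
      k = int (padic_int_val c) - int (padic_int_val d)"
    then obtain c d where cd: "c \<noteq> 0" "d \<noteq> 0"
      "padic_of_int a / padic_of_int b = padic_of_int c / padic_of_int d"
      and k: "k = int (padic_int_val c) - int (padic_int_val d)" by blast
    then have "padic_of_int (a * d) = padic_of_int (c * b)"
      using b by (simp add: frac_eq_eq padic_of_int_mult)
    then have "a * d = c * b" by simp
    then have "padic_int_val a + padic_int_val d = padic_int_val c + padic_int_val b"
      using a b cd by (metis padic_int_val_mult)
    then show "k = int (padic_int_val a) - int (padic_int_val b)"
      using k by linarith
  qed
  then show ?thesis
    using a b by (simp add: padic_val_def)
qed

text \<open>The absolute value \<open>p\<^bsup>-v(x)\<^esup>\<close>.\<close>

definition padic_norm :: "'p::prime_card padic \<Rightarrow> real" where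
  "padic_norm x = (case padic_val x of Fin k \<Rightarrow> real CARD('p) powi (- k) | _ \<Rightarrow> 0)"

lemma padic_val_finite: "x \<noteq> 0 \<Longrightarrow> \<exists>k. padic_val x = Fin k"
  by (simp add: padic_val_def)

lemma card_gt_1: "real CARD('p::prime_card) > 1"
  by (metis of_nat_1 of_nat_less_iff prime_card prime_gt_1_nat)

lemma padic_norm_eq_0_iff [simp]: "padic_norm (x :: 'p::prime_card padic) = 0 \<longleftrightarrow> x = 0"
  using padic_val_finite[of x] card_gt_1[where 'p = 'p]
  by (cases "x = 0") (auto simp: padic_norm_def)

lemma padic_norm_0: "padic_norm 0 = 0"
  by (simp add: padic_norm_def)

lemma padic_norm_nonneg [simp]: "padic_norm x \<ge> 0"
  by (auto simp: padic_norm_def split: extended.splits)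

lemma padic_val_minus: "padic_val (- x) = padic_val x"
proof -
  obtain a b where ab: "b \<noteq> 0" "x = padic_of_int a / padic_of_int b"
    by (rule padic_cases)
  have "padic_int_val (- a) = padic_int_val a"
  proof (cases "a = 0")
    case False
    have "(n \<le> padic_int_val (- a)) = (n \<le> padic_int_val a)" for n
    proof -
      have "residue (- c) n = 0" if "residue c n = 0" for c :: "'a padic_int"
        using that by (simp add: uminus_padic_int.rep_eq)
      from this[of a] this[of "- a"] show ?thesis
        using False padic_int_val_iff[of a n] padic_int_val_iff[of "- a" n] by auto
    qed
    then show ?thesis
      using order_antisym by blast
  qed simp
  then have "padic_val (padic_of_int (- a) / padic_of_int b) = padic_val x"
    using ab padic_val_quot[of a b] padic_val_quot[of "- a" b] by (cases "a = 0") auto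
  then show ?thesis
    using ab by (simp add: padic_of_int_minus)
qed

lemma padic_val_add: "min (padic_val x) (padic_val y) \<le> padic_val (x + y)"
proof (cases "x = 0 \<or> y = 0 \<or> x + y = 0")
  case True
  then show ?thesis by auto
next
  case False
  obtain a b where x: "b \<noteq> 0" "x = padic_of_int a / padic_of_int b"
    by (rule padic_cases)
  obtain c d where y: "d \<noteq> 0" "y = padic_of_int c / padic_of_int d"
    by (rule padic_cases)
  have nz: "a \<noteq> 0" "c \<noteq> 0"
    using False x y by auto
  have xy: "x + y = padic_of_int (a * d + c * b) / padic_of_int (b * d)"
    using x y by (simp add: padic_of_int_add padic_of_int_mult field_simps)
  then have nz': "a * d + c * b \<noteq> 0"
    using False by (metis div_0 padic_of_int_eq_0_iff)
  have "min (padic_int_val (a * d)) (padic_int_val (c * b)) \<le> padic_int_val (a * d + c * b)"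
    using nz nz' x y by (intro padic_int_val_add) auto
  then show ?thesis
    using x y nz nz' unfolding xy
    by (auto simp: padic_val_quot padic_int_val_mult)
qed

lemma padic_norm_minus: "padic_norm (- x) = padic_norm x"
  by (simp add: padic_norm_def padic_val_minus)

lemma padic_norm_add: "padic_norm (x + y) \<le> max (padic_norm x) (padic_norm (y :: 'p::prime_card padic))"
proof (cases "x = 0 \<or> y = 0 \<or> x + y = 0")
  case True
  then show ?thesis by (auto simp: padic_norm_0 le_max_iff_disj)
next
  case False
  then obtain i j k where v: "padic_val x = Fin i" "padic_val y = Fin j" "padic_val (x + y) = Fin k"
    using padic_val_finite by metis
  then have "min i j \<le> k"
    using padic_val_add[of x y] by simp
  then have "- k \<le> - i \<or> - k \<le> - j" by auto
  then have "real CARD('p) powi (- k) \<le> real CARD('p) powi (- i) \<or>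
    real CARD('p) powi (- k) \<le> real CARD('p) powi (- j)"
    using card_gt_1[where 'p = 'p] by (auto intro!: power_int_increasing)
  then show ?thesis
    by (auto simp: padic_norm_def v)
qed

instantiation padic :: (prime_card) metric_space
begin

definition dist_padic :: "'a padic \<Rightarrow> 'a padic \<Rightarrow> real" where
  "dist_padic x y = padic_norm (x - y)"

definition uniformity_padic :: "('a padic \<times> 'a padic) filter" where
  "uniformity_padic = (INF e\<in>{0<..}. principal {(x, y). dist x y < e})"

definition open_padic :: "'a padic set \<Rightarrow> bool" where
  "open_padic U = (\<forall>x\<in>U. eventually (\<lambda>(x', y). x' = x \<longrightarrow> y \<in> U) uniformity)"

instance
proof
  fix x y z :: "'a padic"
  show "dist x y = 0 \<longleftrightarrow> x = y"
    by (simp add: dist_padic_def)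
  have "padic_norm (x - y) = padic_norm ((x - z) + - (y - z))" by simp
  also have "\<dots> \<le> max (padic_norm (x - z)) (padic_norm (y - z))"
    by (metis padic_norm_add padic_norm_minus)
  also have "\<dots> \<le> padic_norm (x - z) + padic_norm (y - z)"
    by (simp add: max_def)
  finally show "dist x y \<le> dist x z + dist y z"
    by (simp add: dist_padic_def)
qed (simp_all add: uniformity_padic_def open_padic_def)

end


section \<open>Characters and Haar measures\<close>

definition unitary_character :: "('a::{topological_space, ab_group_add} \<Rightarrow> complex) \<Rightarrow> bool" where
  "unitary_character \<psi> \<longleftrightarrow> continuous_on UNIV \<psi> \<and>
     (\<forall>x y. \<psi> (x + y) = \<psi> x * \<psi> y) \<and> (\<forall>x. norm (\<psi> x) = 1)"

text \<open>The fractional ideals are the \<open>p\<^sup>n \<int>\<^sub>p\<close> for integers \<open>n\<close>; conductor \<open>\<int>\<^sub>p\<close> means that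
  \<open>\<int>\<^sub>p\<close> is the largest one on which \<open>\<psi>\<close> is trivial.\<close>

definition conductor_padic_Ints :: "('p::prime_card padic \<Rightarrow> complex) \<Rightarrow> bool" where
  "conductor_padic_Ints \<psi> \<longleftrightarrow>
     (\<forall>n::int. (\<forall>x\<in>padic_Ints. \<psi> (of_nat CARD('p) powi n * x) = 1) \<longleftrightarrow> 0 \<le> n)"

text \<open>No regularity is required: on the second countable locally compact groups considered here
  it is automatic.\<close>

definition haar_measure :: "'a::{topological_space, ab_group_add} measure \<Rightarrow> bool" where
  "haar_measure \<mu> \<longleftrightarrow> sets \<mu> = sets borel \<and>
     (\<forall>a. \<forall>A\<in>sets borel. emeasure \<mu> ((+) a ` A) = emeasure \<mu> A) \<and>
     (\<forall>K. compact K \<longrightarrow> emeasure \<mu> K < \<infinity>) \<and>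
     (\<forall>U. open U \<and> U \<noteq> {} \<longrightarrow> emeasure \<mu> U > 0)"


section \<open>The quadratic lattice\<close>

text \<open>With \<open>m = CARD('m)\<close>, an element is a pair of \<open>(x\<^sub>1,\<dots>,x\<^sub>2\<^sub>m)\<close> and \<open>(y\<^sub>1,\<dots>,y\<^sub>2\<^sub>m)\<close>; the indices
  \<open>1,\<dots>,m\<close> are the \<open>Inl i\<close>, and \<open>m+1,\<dots>,2m\<close> are the \<open>Inr i\<close>.\<close>

type_synonym ('p, 'm) quad_space = "('p padic, 'm + 'm) vec \<times> ('p padic, 'm + 'm) vec"

definition quad_form :: "('p::prime_card, 'm::finite) quad_space \<Rightarrow> 'p padic" where
  "quad_form = (\<lambda>(x, y). (\<Sum>i\<in>UNIV. x $ Inl i * y $ Inl i) +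
     of_nat CARD('p) * (\<Sum>i\<in>UNIV. x $ Inr i * y $ Inr i))"

definition bilin_form ::
  "('p::prime_card, 'm::finite) quad_space \<Rightarrow> ('p, 'm) quad_space \<Rightarrow> 'p padic" where
  "bilin_form u v = quad_form (u + v) - quad_form u - quad_form v"

definition lattice_L :: "('p::prime_card, 'm::finite) quad_space set" where
  "lattice_L = {(x, y). \<forall>i. x $ i \<in> padic_Ints \<and> y $ i \<in> padic_Ints}"

definition quad_scale ::
  "'p::prime_card padic \<Rightarrow> ('p, 'm::finite) quad_space \<Rightarrow> ('p, 'm) quad_space" where
  "quad_scale c = (\<lambda>(x, y). (c *s x, c *s y))"

definition C_coeff ::
  "('p::prime_card, 'm::finite) quad_space measure \<Rightarrow> ('p padic \<Rightarrow> complex) \<Rightarrow> nat \<Rightarrow>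
     ('p, 'm) quad_space \<Rightarrow> complex" where
  "C_coeff \<mu> \<psi> r \<eta> =
     (LINT x : quad_scale (of_nat CARD('p) powi (- int r)) ` lattice_L | \<mu>.
        \<psi> (bilin_form \<eta> x) * of_bool (of_nat CARD('p) ^ r * quad_form x \<in> padic_Ints))"

definition C_term ::
  "('p::prime_card, 'm::finite) quad_space measure \<Rightarrow> ('p padic \<Rightarrow> complex) \<Rightarrow>
     ('p, 'm) quad_space \<Rightarrow> complex \<Rightarrow> nat \<Rightarrow> complex" where
  "C_term \<mu> \<psi> \<eta> s r = of_nat CARD('p) powr (- of_nat r * s) * C_coeff \<mu> \<psi> r \<eta>"

definition part1 :: "('p::prime_card, 'm::finite) quad_space \<Rightarrow> ('p padic ^ 'm) \<times> ('p padic ^ 'm)" where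
  "part1 = (\<lambda>(a, b). (\<chi> i. a $ Inl i, \<chi> i. b $ Inl i))"

definition part2 :: "('p::prime_card, 'm::finite) quad_space \<Rightarrow> ('p padic ^ 'm) \<times> ('p padic ^ 'm)" where
  "part2 = (\<lambda>(a, b). (\<chi> i. a $ Inr i, \<chi> i. b $ Inr i))"

definition vector_val :: "('p::prime_card padic ^ 'm) \<times> ('p padic ^ 'm) \<Rightarrow> int extended" where
  "vector_val = (\<lambda>(a, b). Min (range (\<lambda>i. padic_val (a $ i)) \<union> range (\<lambda>i. padic_val (b $ i))))"

definition R_poly :: "nat \<Rightarrow> nat \<Rightarrow> int \<Rightarrow> int \<Rightarrow> int \<Rightarrow> int \<Rightarrow> complex poly" where
  "R_poly p m k1 k2 k k' =
     (let g = (\<lambda>j::int. (of_nat p ^ (nat j * (2 * m - 1)) - 1) / (of_nat p ^ (2 * m - 1) - 1))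
      in smult (of_nat p ^ m)
          ((\<Sum>r = 1..k2. monom (g r) (nat r))
           + smult (g (k1 + 1)) (\<Sum>r = k2 + 1..k2 + k'. monom 1 (nat r))
           + (\<Sum>r = k2 + k' + 1..k. monom (g (k - r + 1)) (nat r))))"

end

theory Submission
  imports Defs "HOL-Number_Theory.Cong"
begin

text \<open>
  The integrand of \<open>C\<^sub>r\<close> is supported on a set stable under translation by \<open>L\<close>. If \<open>\<eta>\<close> is not in
  the dual lattice, translating by a suitable element of \<open>L\<close> multiplies \<open>C\<^sub>r\<close> by a constant
  different from 1, so \<open>C\<^sub>r = 0\<close>; if \<open>\<eta>\<close> is in the dual lattice but not in \<open>L\<close>, the same works for
  \<open>r > 0\<close> with a translation by \<open>p\<^sup>-\<^sup>1\<close> times a basis vector of the second block.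
  If \<open>\<eta> \<in> L\<close>, the integrand is constant on cosets of \<open>L\<close>, so \<open>C\<^sub>r\<close> is a sum over \<open>L / p\<^sup>r L\<close>.
  Detecting \<open>p\<^sup>r | q\<close> by additive characters, indexed by \<open>t = p\<^sup>j u\<close> with \<open>u\<close> a unit, makes it a
  product over the hyperbolic planes; each factor is evaluated by hand, and the remaining sum over
  \<open>u\<close> is a Ramanujan sum in \<open>q(\<eta>) / p\<^bsup>2j\<^esup>\<close>. Writing \<open>r = j + e\<close> and summing over \<open>j\<close> and \<open>e\<close> gives the
  generating function, with \<open>R(Z) = p\<^sup>m \<Sum>\<^sub>j p\<^bsup>(2m-1)j\<^esup> Z\<^sup>j \<Sum>\<^sub>e Z\<^sup>e\<close> over \<open>0 \<le> j \<le> k\<^sub>1\<close> and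
  \<open>1 \<le> e \<le> k - 2j\<close>. The coefficient of \<open>Z\<^sup>r\<close> is therefore a geometric sum of length
  \<open>min(k\<^sub>1 + 1, r, k + 1 - r)\<close>, which is visibly palindromic.
\<close>

section \<open>Exponential sums modulo a prime power\<close>

text \<open>The model is \<open>\<psi> (of_int n / p ^ r)\<close>. Prescribing the kernel exactly,
  and not just a period, makes complete linear sums vanish unless the frequency is divisible by
  \<open>p ^ r\<close>, and the property passes to every smaller power of \<open>p\<close>.\<close>

locale primitive_character =
  fixes p r :: nat and \<theta> :: "int \<Rightarrow> complex"
  assumes prime_p: "prime p"
    and add: "\<theta> (x + y) = \<theta> x * \<theta> y"
    and eq_1_iff: "\<theta> n = 1 \<longleftrightarrow> int p ^ r dvd n"
begin

lemma p_pos: "p > 0" "int p > 0" "int p > 1"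
  using prime_p prime_gt_0_nat prime_gt_1_nat by (auto simp: prime_gt_1_int)

lemma char_0 [simp]: "\<theta> 0 = 1"
  by (simp add: eq_1_iff)

lemma sum: "finite A \<Longrightarrow> \<theta> (\<Sum>i\<in>A. f i) = (\<Prod>i\<in>A. \<theta> (f i))"
  by (induction A rule: finite_induct) (simp_all add: add)

lemma cong:
  assumes "[x = y] (mod int p ^ r)"
  shows "\<theta> x = \<theta> y"
proof -
  have "\<theta> (x - y) = 1"
    using assms by (simp add: eq_1_iff cong_iff_dvd_diff)
  then show ?thesis
    using add[of "x - y" y] by simp
qed

text \<open>As \<open>p ^ r\<close> divides \<open>p ^ (r - e) * n\<close> exactly when
  \<open>p ^ e\<close> divides \<open>n\<close>, sums to a smaller modulus fall under the same
  locale.\<close>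

lemma shift_power: "primitive_character p e (\<lambda>n. \<theta> (int p ^ (r - e) * n))" if "e \<le> r"
proof
  show "prime p" by (fact prime_p)
  show "\<theta> (int p ^ (r - e) * (x + y)) = \<theta> (int p ^ (r - e) * x) * \<theta> (int p ^ (r - e) * y)" for x y
    by (simp add: distrib_left add)
  show "\<theta> (int p ^ (r - e) * n) = 1 \<longleftrightarrow> int p ^ e dvd n" for n
  proof -
    have "int p ^ r = int p ^ (r - e) * int p ^ e"
      using that by (simp flip: power_add)
    then show ?thesis
      using p_pos by (simp add: eq_1_iff)
  qed
qed

end

lemma zdiv_less_bound: "x div M < n" if "x < n * M" "M > 0" for x M n :: int
proof -
  have "x div M * M \<le> x"
    using that by (simp add: minus_mod_eq_div_mult [symmetric])
  with that have "x div M * M < n * M" by linarith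
  with that show ?thesis by simp
qed

lemma sum_mod_shift:
  fixes f :: "int \<Rightarrow> 'a::comm_monoid_add"
  assumes "q > 0" and f: "\<And>x y. [x = y] (mod q) \<Longrightarrow> f x = f y"
  shows "(\<Sum>x\<in>{0..<q}. f (x + c)) = (\<Sum>x\<in>{0..<q}. f x)"
proof (rule sum.reindex_bij_witness[where i = "\<lambda>x. (x - c) mod q" and j = "\<lambda>x. (x + c) mod q"])
  fix a assume "a \<in> {0..<q}"
  then show "((a + c) mod q - c) mod q = a" "((a - c) mod q + c) mod q = a"
    by (simp_all add: mod_simps)
  show "f ((a + c) mod q) = f (a + c)"
    by (rule f) (simp add: cong_def)
qed (use assms in auto)

section \<open>Linear sums and the sum over one hyperbolic plane\<close>

context primitive_character
begin

text \<open>Translating the variable by 1 permutes the residues and multiplies the sum by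
  \<open>\<theta> c\<close>, so the sum is 0 as soon as \<open>\<theta> c\<close> differs from
  1.\<close>

lemma sum_linear:
  "(\<Sum>x\<in>{0..<int p ^ r}. \<theta> (c * x)) = (if int p ^ r dvd c then of_nat p ^ r else 0)"
proof (cases "int p ^ r dvd c")
  case True
  then have "\<theta> (c * x) = 1" for x
    by (simp add: eq_1_iff)
  then show ?thesis
    using True by (simp add: nat_power_eq)
next
  case False
  have "(\<Sum>x\<in>{0..<int p ^ r}. \<theta> (c * (x + 1))) = (\<Sum>x\<in>{0..<int p ^ r}. \<theta> (c * x))"
    using p_pos by (intro sum_mod_shift cong cong_mult) auto
  moreover have "(\<Sum>x\<in>{0..<int p ^ r}. \<theta> (c * (x + 1))) = \<theta> c * (\<Sum>x\<in>{0..<int p ^ r}. \<theta> (c * x))"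
    by (simp add: distrib_left add sum_distrib_left mult.commute)
  moreover have "\<theta> c \<noteq> 1"
    using False by (simp add: eq_1_iff)
  ultimately show ?thesis
    using False by simp
qed

text \<open>The sum over \<open>y\<close> forces \<open>x\<close> to be \<open>- v * a / p\<^sup>J\<close> modulo \<open>p\<^bsup>r - J\<^esup>\<close>.\<close>

lemma hyperbolic_sum_unit:
  fixes u v a b :: int
  assumes J: "J \<le> r" and T: "[T = int p ^ J * u] (mod int p ^ r)" and uv: "[u * v = 1] (mod int p ^ r)"
  shows "(\<Sum>x\<in>{0..<int p ^ r}. \<Sum>y\<in>{0..<int p ^ r}. \<theta> (T * x * y + a * y + b * x)) =
    (if int p ^ J dvd a \<and> int p ^ J dvd b
     then of_nat p ^ (r + J) * \<theta> (- v * (a * b div int p ^ J)) else 0)"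
proof -
  define P where "P = int p"
  define N where "N = P ^ r"
  have P: "P > 0" "P \<noteq> 0" using p_pos by (auto simp: P_def)
  have Nsplit: "N = P ^ J * P ^ (r - J)" "N = P ^ (r - J) * P ^ J"
    using J by (simp_all add: N_def flip: power_add)
  have inner: "(\<Sum>y\<in>{0..<N}. \<theta> (T * x * y + a * y + b * x)) =
      \<theta> (b * x) * (if N dvd P ^ J * u * x + a then of_nat p ^ r else 0)" for x
  proof -
    have "(\<Sum>y\<in>{0..<N}. \<theta> (T * x * y + a * y + b * x)) = (\<Sum>y\<in>{0..<N}. \<theta> (b * x) * \<theta> ((T * x + a) * y))"
      by (rule sum.cong) (auto simp: add[symmetric] algebra_simps)
    also have "\<dots> = \<theta> (b * x) * (if N dvd T * x + a then of_nat p ^ r else 0)"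
      by (simp add: sum_linear N_def P_def flip: sum_distrib_left)
    also have "[T * x + a = P ^ J * u * x + a] (mod N)"
      unfolding N_def P_def by (intro cong_add cong_mult T) auto
    then have "N dvd T * x + a \<longleftrightarrow> N dvd P ^ J * u * x + a"
      by (simp add: cong_dvd_iff)
    finally show ?thesis .
  qed
  show ?thesis
  proof (cases "P ^ J dvd a")
    case False
    have "\<not> N dvd P ^ J * u * x + a" for x
    proof
      assume "N dvd P ^ J * u * x + a"
      then have "P ^ J dvd P ^ J * u * x + a"
        by (rule dvd_trans[rotated]) (simp add: Nsplit)
      then have "P ^ J dvd a"
        by (simp add: mult.assoc dvd_add_right_iff)
      with False show False ..
    qed
    with False show ?thesis
      unfolding P_def[symmetric] N_def[symmetric] inner by simp
  next
    case True
    then obtain a' where a': "a = P ^ J * a'" ..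
    define M where "M = P ^ (r - J)"
    have M: "M > 0" "N = P ^ J * M" using P Nsplit by (auto simp: M_def)
    have uvM: "[u * v = 1] (mod M)"
      using uv by (rule cong_dvd_modulus) (use Nsplit in \<open>simp add: M_def N_def P_def\<close>)
    \<comment> \<open>Cancelling \<open>p ^ J\<close> leaves a linear congruence modulo
      \<open>M\<close>, where \<open>v\<close> still inverts \<open>u\<close>; it determines
      \<open>x\<close> modulo \<open>M\<close> only.\<close>
    have dvd: "N dvd P ^ J * u * x + a \<longleftrightarrow> [x = - v * a'] (mod M)" for x
    proof -
      have "P ^ J * u * x + a = P ^ J * (u * x + a')"
        by (simp add: a' algebra_simps)
      then have "N dvd P ^ J * u * x + a \<longleftrightarrow> M dvd u * x + a'"
        using P by (simp add: M)
      also have "\<dots> \<longleftrightarrow> [u * x = - a'] (mod M)"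
        by (simp add: cong_iff_dvd_diff)
      also have "\<dots> \<longleftrightarrow> [x = - v * a'] (mod M)"
      proof
        assume "[u * x = - a'] (mod M)"
        then have "[v * (u * x) = v * (- a')] (mod M)"
          by (rule cong_scalar_left)
        moreover have "[v * (u * x) = 1 * x] (mod M)"
          using cong_scalar_right[OF uvM, of x] by (simp add: mult_ac)
        ultimately show "[x = - v * a'] (mod M)"
          by (metis cong_sym cong_trans mult_1 mult_minus_left mult_minus_right)
      next
        assume "[x = - v * a'] (mod M)"
        then have "[u * x = u * (- v * a')] (mod M)"
          by (rule cong_scalar_left)
        moreover have "[u * (- v * a') = 1 * (- a')] (mod M)"
          using cong_scalar_right[OF uvM, of "- a'"] by (simp add: mult_ac)
        ultimately show "[u * x = - a'] (mod M)"
          by (metis cong_trans mult_1)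
      qed
      finally show ?thesis .
    qed
    define x0 where "x0 = (- v * a') mod M"
    have x0: "0 \<le> x0" "x0 < M" using M by (auto simp: x0_def)
    \<comment> \<open>A class modulo \<open>M\<close> has exactly \<open>p ^ J\<close>
      representatives below \<open>N\<close>, numbered by \<open>z\<close>.\<close>
    have set: "{x \<in> {0..<N}. [x = - v * a'] (mod M)} = (\<lambda>z. x0 + M * z) ` {0..<P ^ J}"
    proof (intro equalityI subsetI)
      fix x assume x: "x \<in> {x \<in> {0..<N}. [x = - v * a'] (mod M)}"
      then have "x mod M = x0"
        by (simp add: cong_def x0_def)
      then have "x = x0 + M * (x div M)"
        by (metis mod_mult_div_eq)
      moreover have "0 \<le> x div M"
        using x M by (simp add: pos_imp_zdiv_nonneg_iff)
      moreover have "x div M < P ^ J"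
        using x M by (intro zdiv_less_bound) (simp_all add: mult.commute)
      ultimately show "x \<in> (\<lambda>z. x0 + M * z) ` {0..<P ^ J}" by auto
    next
      fix x assume "x \<in> (\<lambda>z. x0 + M * z) ` {0..<P ^ J}"
      then obtain z where z: "x = x0 + M * z" "z \<in> {0..<P ^ J}" by blast
      then have "0 \<le> z" "z + 1 \<le> P ^ J" by auto
      have "M * (z + 1) \<le> M * P ^ J"
        using M \<open>z + 1 \<le> P ^ J\<close> by (intro mult_left_mono) auto
      then have "x < N" using z(1) x0 M \<open>0 \<le> z\<close> by (simp add: algebra_simps)
      moreover have "[x = - v * a'] (mod M)"
        by (simp add: z x0_def cong_def)
      ultimately show "x \<in> {x \<in> {0..<N}. [x = - v * a'] (mod M)}"
        using z(1) x0 M \<open>0 \<le> z\<close> by simp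
    qed
    have "(\<Sum>x\<in>{0..<N}. \<Sum>y\<in>{0..<N}. \<theta> (T * x * y + a * y + b * x)) =
        (\<Sum>x\<in>{x \<in> {0..<N}. [x = - v * a'] (mod M)}. \<theta> (b * x) * of_nat p ^ r)"
      unfolding inner dvd by (intro sum.mono_neutral_cong_right) auto
    also have "\<dots> = (\<Sum>z\<in>{0..<P ^ J}. \<theta> (b * (x0 + M * z)) * of_nat p ^ r)"
      unfolding set using M by (subst sum.reindex) (auto simp: inj_on_def)
    also have "\<dots> = \<theta> (b * x0) * of_nat p ^ r * (\<Sum>z\<in>{0..<P ^ J}. \<theta> (M * (b * z)))"
      by (simp add: distrib_left add sum_distrib_left mult_ac)
    \<comment> \<open>The sum over the representatives is again linear, now to the modulus
      \<open>p ^ J\<close>; it produces the divisibility condition on \<open>b\<close>.\<close>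
    also have "(\<Sum>z\<in>{0..<P ^ J}. \<theta> (M * (b * z))) = (if P ^ J dvd b then of_nat p ^ J else 0)"
      using primitive_character.sum_linear[OF shift_power[OF J], of b] by (simp add: P_def M_def)
    also have "\<theta> (b * x0) * of_nat p ^ r * (if P ^ J dvd b then of_nat p ^ J else 0) =
      (if P ^ J dvd b then of_nat p ^ (r + J) * \<theta> (- v * (a * b div P ^ J)) else 0)"
    proof (cases "P ^ J dvd b")
      case True
      \<comment> \<open>\<open>x0\<close> is controlled only modulo \<open>M\<close>, but the factor
        \<open>p ^ J\<close> of \<open>b\<close> lifts this to a congruence modulo \<open>N\<close>,
        which is what \<open>\<theta>\<close> sees.\<close>
      have "[x0 = - v * a'] (mod M)"
        by (simp add: x0_def cong_def)
      then have "N dvd b * (x0 - (- v * a'))"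
        unfolding M cong_iff_dvd_diff using True by (rule mult_dvd_mono[rotated])
      then have "[b * x0 = b * (- v * a')] (mod N)"
        by (simp only: cong_iff_dvd_diff right_diff_distrib)
      moreover have "- v * (a * b div P ^ J) = b * (- v * a')"
        using P by (simp add: a' mult_ac)
      ultimately have "\<theta> (b * x0) = \<theta> (- v * (a * b div P ^ J))"
        unfolding N_def P_def by (metis cong)
      with True show ?thesis by (simp add: power_add)
    qed simp
    finally show ?thesis
      using True by (simp add: P_def N_def)
  qed
qed

end

section \<open>Units modulo a prime power and Ramanujan sums\<close>

lemma coprime_inverse:
  fixes u :: int
  assumes "prime p" "\<not> int p dvd u"
  shows "\<exists>v. \<not> int p dvd v \<and> [u * v = 1] (mod int p ^ e)"
proof -
  \<comment> \<open>With the exponent \<open>Suc e\<close> the modulus is divisible by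
    \<open>p\<close> even for \<open>e = 0\<close>, so that \<open>v\<close> is prime to
    \<open>p\<close> in every case.\<close>
  have "coprime u (int p ^ Suc e)"
    using assms by (metis coprime_commute coprime_power_right_iff prime_imp_coprime prime_nat_int_transfer)
  then obtain v where v: "[u * v = 1] (mod int p ^ Suc e)"
    by (metis cong_solve_coprime_int)
  then have "[u * v = 1] (mod int p ^ e)"
    by (rule cong_dvd_modulus) simp
  moreover have "\<not> int p dvd v"
  proof
    assume "int p dvd v"
    moreover have "[u * v = 1] (mod int p)"
      using v by (rule cong_dvd_modulus) simp
    ultimately have "int p dvd 1"
      by (metis cong_dvd_iff dvd_mult)
    then show False using assms(1) by (simp add: not_prime_unit)
  qed
  ultimately show ?thesis by blast
qed

text \<open>For \<open>e = 0\<close> the set is empty, since \<open>p\<close> divides 0; the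
  splitting by valuation below only uses exponents \<open>r - j\<close> with
  \<open>j < r\<close>.\<close>

definition units_below :: "nat \<Rightarrow> nat \<Rightarrow> int set" where
  "units_below p e = {u \<in> {0..<int p ^ e}. \<not> int p dvd u}"

lemma finite_units_below [simp]: "finite (units_below p e)"
  by (rule finite_subset[of _ "{0..<int p ^ e}"]) (auto simp: units_below_def)

lemma sum_split_units:
  fixes f :: "int \<Rightarrow> 'a::comm_monoid_add"
  assumes "p > 0"
  shows "(\<Sum>t\<in>{0..<int p ^ Suc e}. f t) = (\<Sum>u\<in>units_below p (Suc e). f u) + (\<Sum>t\<in>{0..<int p ^ e}. f (int p * t))"
proof -
  have set: "{0..<int p ^ Suc e} - units_below p (Suc e) = (\<lambda>t. int p * t) ` {0..<int p ^ e}"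
  proof (intro equalityI subsetI)
    fix t assume t: "t \<in> {0..<int p ^ Suc e} - units_below p (Suc e)"
    then obtain t' where t': "t = int p * t'" by (auto simp: units_below_def)
    with t assms show "t \<in> (\<lambda>t. int p * t) ` {0..<int p ^ e}"
      by (auto simp: zero_le_mult_iff)
  qed (use assms in \<open>auto simp: units_below_def\<close>)
  have "(\<Sum>t\<in>{0..<int p ^ Suc e}. f t) =
      (\<Sum>t\<in>{0..<int p ^ Suc e} - units_below p (Suc e). f t) + (\<Sum>u\<in>units_below p (Suc e). f u)"
    by (rule sum.subset_diff) (auto simp: units_below_def)
  also have "(\<Sum>t\<in>{0..<int p ^ Suc e} - units_below p (Suc e). f t) = (\<Sum>t\<in>{0..<int p ^ e}. f (int p * t))"
    unfolding set using assms by (subst sum.reindex) (auto simp: inj_on_def)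
  finally show ?thesis by (simp add: add.commute)
qed

text \<open>Iterating the splitting into units and multiples of \<open>p\<close> sorts residues by
  valuation: a nonzero \<open>t\<close> is \<open>p ^ j * u\<close>, with the unit \<open>u\<close>
  counted modulo \<open>p ^ (r - j)\<close>, and 0 stands apart.\<close>

lemma sum_split_valuation:
  fixes f :: "int \<Rightarrow> 'a::comm_monoid_add"
  assumes "p > 0"
  shows "(\<Sum>t\<in>{0..<int p ^ r}. f t) = f 0 + (\<Sum>j<r. \<Sum>u\<in>units_below p (r - j). f (int p ^ j * u))"
proof (induction r arbitrary: f)
  case 0
  have "{0..<1::int} = {0}" by auto
  then show ?case by simp
next
  case (Suc r)
  have "(\<Sum>t\<in>{0..<int p ^ Suc r}. f t) = (\<Sum>u\<in>units_below p (Suc r). f u) +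
      (f (int p * 0) + (\<Sum>j<r. \<Sum>u\<in>units_below p (r - j). f (int p * (int p ^ j * u))))"
    by (simp only: sum_split_units[OF assms] Suc)
  also have "\<dots> = f 0 + (\<Sum>j<Suc r. \<Sum>u\<in>units_below p (Suc r - j). f (int p ^ j * u))"
    by (subst sum.lessThan_Suc_shift) (simp add: add_ac mult.assoc)
  finally show ?case .
qed

text \<open>Inversion is an involution of the units. As \<open>v u\<close> is an arbitrary integer
  inverse, its reduction \<open>w u\<close> is what reindexes the sum.\<close>

lemma sum_units_inverse:
  fixes f :: "int \<Rightarrow> 'a::comm_monoid_add"
  assumes p: "prime p" and inv: "\<And>u. u \<in> units_below p e \<Longrightarrow> [u * v u = 1] (mod int p ^ e)"
    and f: "\<And>x y. [x = y] (mod int p ^ e) \<Longrightarrow> f x = f y" and e: "e > 0"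
  shows "(\<Sum>u\<in>units_below p e. f (v u)) = (\<Sum>u\<in>units_below p e. f u)"
proof -
  let ?q = "int p ^ e"
  have q: "?q > 0" using p by (simp add: prime_gt_0_nat)
  have pq: "int p dvd ?q" using e by (simp add: dvd_power)
  define w where "w u = v u mod ?q" for u
  have w: "w u \<in> units_below p e" "[u * w u = 1] (mod ?q)" if u: "u \<in> units_below p e" for u
  proof -
    show 1: "[u * w u = 1] (mod ?q)"
      using inv[OF u] by (simp add: w_def cong_def mod_simps)
    have "\<not> int p dvd w u"
    proof
      assume "int p dvd w u"
      moreover have "[u * w u = 1] (mod int p)"
        using 1 pq by (rule cong_dvd_modulus)
      ultimately have "int p dvd 1"
        by (metis cong_dvd_iff dvd_mult)
      then show False using p by (simp add: not_prime_unit)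
    qed
    then show "w u \<in> units_below p e"
      using q by (simp add: units_below_def w_def)
  qed
  have ww: "w (w u) = u" if u: "u \<in> units_below p e" for u
  proof -
    have "[u * (w u * w (w u)) = u * 1] (mod ?q)"
      by (intro cong_scalar_left w u)
    moreover have "[(u * w u) * w (w u) = 1 * w (w u)] (mod ?q)"
      by (intro cong_scalar_right w u)
    ultimately have "[u = w (w u)] (mod ?q)"
      by (metis cong_sym cong_trans mult.assoc mult_1 mult_1_right)
    moreover have "w (w u) \<in> units_below p e" using w u by blast
    ultimately show ?thesis
      using u by (simp add: units_below_def cong_def)
  qed
  show ?thesis
  proof (rule sum.reindex_bij_witness[where i = w and j = w])
    show "f (w u) = f (v u)" for u
      by (rule f) (simp add: w_def cong_def)
  qed (use w ww in auto)
qed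

text \<open>The complete sum minus the sum over multiples of \<open>p\<close>; the latter is a
  complete sum to the modulus \<open>p ^ (r - 1)\<close>.\<close>

lemma (in primitive_character) ramanujan_sum:
  assumes "r > 0"
  shows "(\<Sum>u\<in>units_below p r. \<theta> (w * u)) =
    (if int p ^ r dvd w then of_nat p ^ r else 0) -
    (if int p ^ (r - 1) dvd w then of_nat p ^ (r - 1) else 0)"
proof -
  obtain e where e: "r = Suc e" using assms by (cases r) auto
  have "(\<Sum>t\<in>{0..<int p ^ e}. \<theta> (w * (int p * t))) = (if int p ^ e dvd w then of_nat p ^ e else 0)"
    using primitive_character.sum_linear[OF shift_power[of e], of w]
    by (simp add: e mult.left_commute)
  then show ?thesis
    using sum_linear[of w] sum_split_units[OF p_pos(1), of "\<lambda>u. \<theta> (w * u)" e]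
    unfolding e by (simp add: algebra_simps del: power_Suc)
qed

section \<open>Sums over isotropic points of several hyperbolic planes\<close>

definition point_indices :: "int \<Rightarrow> ('i \<Rightarrow> int \<times> int) set" where
  "point_indices q = PiE UNIV (\<lambda>_. {0..<q} \<times> {0..<q})"

lemma finite_point_indices [simp]: "finite (point_indices q :: ('i::finite \<Rightarrow> int \<times> int) set)"
  unfolding point_indices_def by (intro finite_PiE) auto

lemma prod_if_const:
  fixes f :: "'i::finite \<Rightarrow> 'a::comm_semiring_1"
  shows "(\<Prod>i\<in>UNIV. if Q i then f i else 0) = (if \<forall>i. Q i then \<Prod>i\<in>UNIV. f i else 0)"
proof (cases "\<forall>i. Q i")
  case False
  then obtain i where "\<not> Q i" by blast
  then show ?thesis
    using False by (auto intro!: prod_zero bexI[of _ i])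
qed simp

context primitive_character
begin

text \<open>Orthogonality of characters; \<open>t\<close> becomes the dual variable that turns the
  condition on the quadratic form into an exponential sum.\<close>

lemma indicator_dvd: "of_bool (int p ^ r dvd n) = (\<Sum>t\<in>{0..<int p ^ r}. \<theta> (n * t)) / of_nat p ^ r"
  using p_pos by (simp add: sum_linear)

text \<open>After the divisibility condition is expanded in characters, the exponent for fixed
  \<open>t\<close> is a sum over the planes, so the sum over all points factors.\<close>

lemma isotropic_sum_eq_prod:
  fixes w A B :: "'i::finite \<Rightarrow> int"
  shows "of_nat p ^ r * (\<Sum>F\<in>point_indices (int p ^ r).
      \<theta> (\<Sum>i\<in>UNIV. w i * (A i * snd (F i) + B i * fst (F i))) *
      of_bool (int p ^ r dvd (\<Sum>i\<in>UNIV. w i * (fst (F i) * snd (F i))))) =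
    (\<Sum>t\<in>{0..<int p ^ r}. \<Prod>i\<in>UNIV. \<Sum>x\<in>{0..<int p ^ r}. \<Sum>y\<in>{0..<int p ^ r}.
      \<theta> (w i * t * x * y + w i * A i * y + w i * B i * x))"
proof -
  let ?q = "int p ^ r"
  have "(\<Sum>t\<in>{0..<?q}. \<Prod>i\<in>UNIV. \<Sum>x\<in>{0..<?q}. \<Sum>y\<in>{0..<?q}.
      \<theta> (w i * t * x * y + w i * A i * y + w i * B i * x)) =
    (\<Sum>t\<in>{0..<?q}. \<Prod>i\<in>UNIV. \<Sum>z\<in>{0..<?q} \<times> {0..<?q}.
      \<theta> (w i * t * fst z * snd z + w i * A i * snd z + w i * B i * fst z))"
    by (simp add: sum.cartesian_product case_prod_unfold)
  also have "\<dots> = (\<Sum>t\<in>{0..<?q}. \<Sum>F\<in>point_indices ?q. \<Prod>i\<in>UNIV.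
      \<theta> (w i * t * fst (F i) * snd (F i) + w i * A i * snd (F i) + w i * B i * fst (F i)))"
    unfolding point_indices_def by (subst prod_sum_PiE) auto
  also have "\<dots> = (\<Sum>F\<in>point_indices ?q. \<Sum>t\<in>{0..<?q}.
      \<theta> (\<Sum>i\<in>UNIV. w i * (A i * snd (F i) + B i * fst (F i))) *
      \<theta> ((\<Sum>i\<in>UNIV. w i * (fst (F i) * snd (F i))) * t))"
  proof (subst sum.swap, intro sum.cong refl)
    fix t and F :: "'i \<Rightarrow> int \<times> int"
    have "(\<Prod>i\<in>UNIV. \<theta> (w i * t * fst (F i) * snd (F i) + w i * A i * snd (F i) + w i * B i * fst (F i))) =
        \<theta> (\<Sum>i\<in>UNIV. w i * t * fst (F i) * snd (F i) + w i * A i * snd (F i) + w i * B i * fst (F i))"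
      by (simp add: sum)
    also have "(\<Sum>i\<in>UNIV. w i * t * fst (F i) * snd (F i) + w i * A i * snd (F i) + w i * B i * fst (F i)) =
        (\<Sum>i\<in>UNIV. w i * (A i * snd (F i) + B i * fst (F i))) + (\<Sum>i\<in>UNIV. w i * (fst (F i) * snd (F i))) * t"
      by (simp add: sum_distrib_left sum.distrib algebra_simps)
    finally show "(\<Prod>i\<in>UNIV. \<theta> (w i * t * fst (F i) * snd (F i) + w i * A i * snd (F i) + w i * B i * fst (F i))) =
        \<theta> (\<Sum>i\<in>UNIV. w i * (A i * snd (F i) + B i * fst (F i))) * \<theta> ((\<Sum>i\<in>UNIV. w i * (fst (F i) * snd (F i))) * t)"
      by (simp only: add)
  qed
  also have "\<dots> = of_nat p ^ r * (\<Sum>F\<in>point_indices ?q.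
      \<theta> (\<Sum>i\<in>UNIV. w i * (A i * snd (F i) + B i * fst (F i))) *
      of_bool (?q dvd (\<Sum>i\<in>UNIV. w i * (fst (F i) * snd (F i)))))"
    unfolding indicator_dvd sum_distrib_left using p_pos by (simp add: sum_divide_distrib sum_distrib_left)
  finally show ?thesis by simp
qed

text \<open>The first summand is the contribution of \<open>t = 0\<close>, the \<open>j\<close>-th
  one that of \<open>t = p ^ j * u\<close> with \<open>u\<close> a unit. The weights
  \<open>p ^ d i\<close> treat the planes of both blocks at once; \<open>d i \<le> 1\<close> and
  \<open>j < r\<close> keep \<open>j + d i\<close> within the range of
  \<open>hyperbolic_sum_unit\<close>.\<close>

lemma isotropic_sum:
  fixes A B :: "'i::finite \<Rightarrow> int" and d :: "'i \<Rightarrow> nat"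
  assumes d: "\<And>i. d i \<le> 1"
  defines "w \<equiv> \<lambda>i. int p ^ d i"
  defines "Q \<equiv> \<Sum>i\<in>UNIV. w i * (A i * B i)"
  shows "of_nat p ^ r * (\<Sum>F\<in>point_indices (int p ^ r).
      \<theta> (\<Sum>i\<in>UNIV. w i * (A i * snd (F i) + B i * fst (F i))) *
      of_bool (int p ^ r dvd (\<Sum>i\<in>UNIV. w i * (fst (F i) * snd (F i))))) =
    of_bool (\<forall>i. int p ^ r dvd w i * A i \<and> int p ^ r dvd w i * B i) * of_nat p ^ (2 * r * CARD('i)) +
    (\<Sum>j<r. of_bool (\<forall>i. int p ^ j dvd A i \<and> int p ^ j dvd B i) *
      of_nat p ^ ((r + j) * CARD('i) + (\<Sum>i\<in>UNIV. d i)) *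
      (of_nat p ^ (r - j) * of_bool (int p ^ (r + j) dvd Q) -
       of_nat p ^ (r - j - 1) * of_bool (int p ^ (r + j - 1) dvd Q)))"
proof -
  let ?q = "int p ^ r"
  define G where "G t i = (\<Sum>x\<in>{0..<?q}. \<Sum>y\<in>{0..<?q}.
      \<theta> (w i * t * x * y + w i * A i * y + w i * B i * x))" for t i
  have G0: "(\<Prod>i\<in>UNIV. G 0 i) = of_bool (\<forall>i. ?q dvd w i * A i \<and> ?q dvd w i * B i) * of_nat p ^ (2 * r * CARD('i))"
  proof -
    \<comment> \<open>Here \<open>t = 0\<close> is read as \<open>p ^ r * 1\<close> modulo
      \<open>p ^ r\<close>, that is, \<open>J = r\<close> and \<open>u = v = 1\<close>; the
      character value that remains is trivial.\<close>
    have "G 0 i = (if ?q dvd w i * A i \<and> ?q dvd w i * B i then of_nat p ^ (r + r) else 0)" for i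
    proof -
      have "\<theta> (- 1 * (w i * A i * (w i * B i) div ?q)) = 1" if dvd: "?q dvd w i * A i" "?q dvd w i * B i"
      proof -
        obtain c where "w i * A i = ?q * c" using dvd(1) ..
        then have "w i * A i * (w i * B i) div ?q = c * (w i * B i)"
          using p_pos by simp
        then show ?thesis
          using dvd(2) by (simp only: eq_1_iff) simp
      qed
      then show ?thesis
        using hyperbolic_sum_unit[of r 0 1 1 "w i * A i" "w i * B i"]
        unfolding G_def by (simp add: cong_def)
    qed
    then show ?thesis
      by (simp add: prod_if_const mult_2 distrib_right flip: power_mult)
  qed
  have Gj: "(\<Sum>u\<in>units_below p (r - j). \<Prod>i\<in>UNIV. G (int p ^ j * u) i) =
      of_bool (\<forall>i. int p ^ j dvd A i \<and> int p ^ j dvd B i) *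
      of_nat p ^ ((r + j) * CARD('i) + (\<Sum>i\<in>UNIV. d i)) *
      (of_nat p ^ (r - j) * of_bool (int p ^ (r + j) dvd Q) -
       of_nat p ^ (r - j - 1) * of_bool (int p ^ (r + j - 1) dvd Q))" if j: "j < r" for j
  proof -
    \<comment> \<open>The inverses are taken modulo the full \<open>p ^ r\<close>, as the evaluation
      of a plane demands, although \<open>u\<close> runs modulo \<open>p ^ (r - j)\<close>
      only.\<close>
    have "\<exists>v. \<forall>u\<in>units_below p (r - j). [u * v u = 1] (mod ?q)"
      using coprime_inverse[OF prime_p] by (intro bchoice) (auto simp: units_below_def)
    then obtain v where v: "\<And>u. u \<in> units_below p (r - j) \<Longrightarrow> [u * v u = 1] (mod ?q)" by blast
    have G: "G (int p ^ j * u) i = (if int p ^ j dvd A i \<and> int p ^ j dvd B i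
        then of_nat p ^ (r + (j + d i)) * \<theta> (- v u * (w i * (A i * B i) div int p ^ j)) else 0)"
      if u: "u \<in> units_below p (r - j)" for u i
    proof -
      have "j + d i \<le> r" using j d[of i] by linarith
      \<comment> \<open>The weight cancels, so planes of both blocks impose the same divisibility by
        \<open>p ^ j\<close>.\<close>
      have dvd: "int p ^ (j + d i) dvd w i * n \<longleftrightarrow> int p ^ j dvd n" for n
        using p_pos by (simp add: w_def power_add mult.commute)
      have "w i * A i * (w i * B i) div int p ^ (j + d i) = w i * (A i * B i) div int p ^ j"
      proof -
        have "w i * A i * (w i * B i) div int p ^ (j + d i) =
          (w i * (w i * (A i * B i))) div (w i * int p ^ j)"
          by (simp add: w_def power_add mult_ac)
        then show ?thesis using p_pos by (simp add: w_def)
      qed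
      then show ?thesis
        unfolding G_def
        using hyperbolic_sum_unit[OF \<open>j + d i \<le> r\<close> _ v[OF u], of "w i * (int p ^ j * u)" "w i * A i" "w i * B i"]
        by (simp add: dvd) (simp add: w_def power_add mult_ac)
    qed
    show ?thesis
    proof (cases "\<forall>i. int p ^ j dvd A i \<and> int p ^ j dvd B i")
      case False
      then have "(\<Prod>i\<in>UNIV. G (int p ^ j * u) i) = 0" if "u \<in> units_below p (r - j)" for u
        by (simp only: G[OF that] prod_if_const if_False)
      then have "(\<Sum>u\<in>units_below p (r - j). \<Prod>i\<in>UNIV. G (int p ^ j * u) i) = 0"
        by (intro sum.neutral ballI)
      moreover have "of_bool (\<forall>i. int p ^ j dvd A i \<and> int p ^ j dvd B i) = (0 :: complex)"
        using False by (simp only: of_bool_def if_False)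
      ultimately show ?thesis by (simp only: mult_zero_left)
    next
      case True
      then obtain A' B' where A': "\<And>i. A i = int p ^ j * A' i" and B': "\<And>i. B i = int p ^ j * B' i"
        unfolding dvd_def by metis
      define Q' where "Q' = (\<Sum>i\<in>UNIV. w i * (A' i * B' i))"
      have Q: "Q = int p ^ j * (int p ^ j * Q')"
        by (simp add: Q_def Q'_def A' B' sum_distrib_left mult_ac)
      have dvdQ: "int p ^ (j + (j + n)) dvd Q \<longleftrightarrow> int p ^ n dvd Q'" for n
        using p_pos by (simp add: Q power_add)
      have "(\<Prod>i\<in>UNIV. G (int p ^ j * u) i) =
          of_nat p ^ ((r + j) * CARD('i) + (\<Sum>i\<in>UNIV. d i)) * \<theta> (int p ^ j * (- Q' * v u))"
        if u: "u \<in> units_below p (r - j)" for u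
      proof -
        have "(\<Prod>i\<in>UNIV. G (int p ^ j * u) i) =
            (\<Prod>i\<in>UNIV. of_nat p ^ (r + (j + d i))) * (\<Prod>i\<in>UNIV. \<theta> (- v u * (w i * (A i * B i) div int p ^ j)))"
          using True by (simp add: G[OF u] prod.distrib)
        also have "(\<Prod>i\<in>UNIV. of_nat p ^ (r + (j + d i)) :: complex) = of_nat p ^ ((r + j) * CARD('i) + (\<Sum>i\<in>UNIV. d i))"
          by (simp add: sum.distrib algebra_simps flip: power_sum)
        also have "w i * (A i * B i) div int p ^ j = int p ^ j * (w i * (A' i * B' i))" for i
          using p_pos by (simp add: A' B' mult.left_commute[of "w i"] mult.assoc)
        then have "(\<Prod>i\<in>UNIV. \<theta> (- v u * (w i * (A i * B i) div int p ^ j))) = \<theta> (int p ^ j * (- Q' * v u))"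
          by (simp add: Q'_def sum_distrib_left sum_negf mult_ac flip: sum)
        finally show ?thesis .
      qed
      then have "(\<Sum>u\<in>units_below p (r - j). \<Prod>i\<in>UNIV. G (int p ^ j * u) i) =
          of_nat p ^ ((r + j) * CARD('i) + (\<Sum>i\<in>UNIV. d i)) * (\<Sum>u\<in>units_below p (r - j). \<theta> (int p ^ j * (- Q' * v u)))"
        by (simp add: sum_distrib_left)
      \<comment> \<open>The summand depends on \<open>v u\<close> only modulo
        \<open>p ^ (r - j)\<close>, so the inverse may be replaced by \<open>u\<close> itself, which
        leaves a Ramanujan sum.\<close>
      also have "(\<Sum>u\<in>units_below p (r - j). \<theta> (int p ^ j * (- Q' * v u))) =
          (\<Sum>u\<in>units_below p (r - j). \<theta> (int p ^ j * (- Q' * u)))"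
      proof (rule sum_units_inverse[OF prime_p])
        show "[u * v u = 1] (mod int p ^ (r - j))" if "u \<in> units_below p (r - j)" for u
          using v[OF that] by (rule cong_dvd_modulus) (simp add: le_imp_power_dvd)
        show "\<theta> (int p ^ j * (- Q' * x)) = \<theta> (int p ^ j * (- Q' * y))" if "[x = y] (mod int p ^ (r - j))" for x y
          using primitive_character.cong[OF shift_power[of "r - j"] cong_scalar_left[OF that, of "- Q'"]] j
          by simp
      qed (use j in simp)
      also have "\<dots> = (if int p ^ (r - j) dvd - Q' then of_nat p ^ (r - j) else 0) -
          (if int p ^ (r - j - 1) dvd - Q' then of_nat p ^ (r - j - 1) else 0)"
        using primitive_character.ramanujan_sum[OF shift_power[of "r - j"], of "- Q'"] j by simp
      \<comment> \<open>Because \<open>Q = p ^ (2 * j) * Q'\<close>, the exponents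
        \<open>r - j\<close> and \<open>r - j - 1\<close> for \<open>Q'\<close> become
        \<open>r + j\<close> and \<open>r + j - 1\<close> for \<open>Q\<close>.\<close>
      also have "\<dots> = of_nat p ^ (r - j) * of_bool (int p ^ (r + j) dvd Q) -
          of_nat p ^ (r - j - 1) * of_bool (int p ^ (r + j - 1) dvd Q)"
        using dvdQ[of "r - j"] dvdQ[of "r - j - 1"] j by (simp add: add.commute)
      finally show ?thesis using True by simp
    qed
  qed
  have "(\<Sum>t\<in>{0..<?q}. \<Prod>i\<in>UNIV. G t i) =
      (\<Prod>i\<in>UNIV. G 0 i) + (\<Sum>j<r. \<Sum>u\<in>units_below p (r - j). \<Prod>i\<in>UNIV. G (int p ^ j * u) i)"
    by (rule sum_split_valuation) (rule p_pos)
  then show ?thesis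
    unfolding isotropic_sum_eq_prod G_def[symmetric] G0 using Gj by simp
qed

end

section \<open>Arithmetic of \<open>p\<close>-adic numbers\<close>

lemma residue_add: "residue (x + y :: 'p::prime_card padic_int) n = (residue x n + residue y n) mod int CARD('p) ^ n"
  by (simp add: plus_padic_int.rep_eq)

lemma residue_diff: "residue (x - y :: 'p::prime_card padic_int) n = (residue x n - residue y n) mod int CARD('p) ^ n"
  by (simp add: minus_padic_int.rep_eq)

lemma residue_mult: "residue (x * y :: 'p::prime_card padic_int) n = (residue x n * residue y n) mod int CARD('p) ^ n"
  by (simp add: times_padic_int.rep_eq)

lemma residue_of_nat: "residue (of_nat a :: 'p::prime_card padic_int) n = int a mod int CARD('p) ^ n"
  by (induction a) (simp_all add: zero_padic_int.rep_eq residue_add one_padic_int.rep_eq mod_simps add.commute)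

lemma residue_of_int: "residue (of_int a :: 'p::prime_card padic_int) n = a mod int CARD('p) ^ n"
  by (cases a rule: int_cases2) (simp_all add: residue_of_nat uminus_padic_int.rep_eq mod_simps)

lemma residue_self_mod: "residue (x :: 'p::prime_card padic_int) n mod int CARD('p) ^ n = residue x n"
  by (rule residue_mod) simp

lemma padic_int_eqI: "(\<And>n. residue x n = residue y n) \<Longrightarrow> x = y"
  by (simp add: residue_inject[symmetric] fun_eq_iff)

lemma card_int_gt_1: "int CARD('p::prime_card) > 1"
  using prime_card[where 'a = 'p] prime_gt_1_nat by force

text \<open>The quotient is built from residues. Dividing by \<open>p ^ n\<close> loses
  \<open>n\<close> digits, so its \<open>k\<close>-th residue is read off from level
  \<open>n + k\<close>.\<close>

lemma residue_eq_0_imp_dvd: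
  fixes z :: "'p::prime_card padic_int"
  assumes "residue z n = 0"
  shows "\<exists>w. z = of_nat CARD('p) ^ n * w"
proof -
  let ?p = "int CARD('p)"
  define f where "f k = residue z (n + k) div ?p ^ n" for k
  have p: "?p > 0" using card_int_gt_1[where 'p = 'p] by linarith
  have f: "f \<in> {f. \<forall>m n. m \<le> n \<longrightarrow> f n mod ?p ^ m = f m}"
  proof (clarify)
    fix i j :: nat assume "i \<le> j"
    then have "residue z (n + i) = residue z (n + j) mod (?p ^ n * ?p ^ i)"
      by (subst residue_mod[symmetric, of _ "n + j"]) (simp_all add: power_add)
    then show "f j mod ?p ^ i = f i"
      using p by (simp add: f_def zmod_zmult2_eq)
  qed
  have "z = of_nat CARD('p) ^ n * Abs_padic_int f"
  proof (rule padic_int_eqI)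
    fix k
    have "residue z (n + k) mod ?p ^ n = 0"
      using assms by (simp add: residue_mod)
    then have "?p ^ n * f k = residue z (n + k)"
      unfolding f_def by auto
    moreover have "residue z (n + k) mod ?p ^ k = residue z k"
      by (rule residue_mod) simp
    ultimately show "residue z k = residue (of_nat CARD('p) ^ n * Abs_padic_int f :: 'p padic_int) k"
      using residue_of_nat[of "CARD('p) ^ n" k, where 'p = 'p]
      by (simp add: residue_mult Abs_padic_int_inverse[OF f] mod_simps)
  qed
  then show ?thesis ..
qed

text \<open>Inverses exist modulo every \<open>p ^ n\<close>, and uniqueness of inverses makes their
  reductions a compatible system.\<close>

lemma padic_int_unit_inverse:
  fixes z :: "'p::prime_card padic_int"
  assumes "residue z 1 \<noteq> 0"
  shows "\<exists>w. z * w = 1"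
proof -
  let ?p = "int CARD('p)"
  have p: "?p > 0" using card_int_gt_1[where 'p = 'p] by linarith
  have "\<exists>v. [residue z n * v = 1] (mod ?p ^ n)" for n
  proof (cases n)
    case (Suc i)
    have "\<not> ?p dvd residue z n"
      using residue_mod[of 1 n z] assms Suc by auto
    then have "coprime (residue z n) ?p"
      by (metis coprime_commute prime_card_int prime_imp_coprime)
    then have "coprime (residue z n) (?p ^ n)" by simp
    then show ?thesis by (metis cong_solve_coprime_int)
  qed simp
  then obtain v where v: "\<And>n. [residue z n * v n = 1] (mod ?p ^ n)" by metis
  define f where "f n = v n mod ?p ^ n" for n
  have zf: "[residue z n * f n = 1] (mod ?p ^ n)" for n
    using v[of n] by (simp add: f_def cong_def mod_simps)
  have f: "f \<in> {f. \<forall>m n. m \<le> n \<longrightarrow> f n mod ?p ^ m = f m}"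
  proof (clarify)
    fix i j :: nat assume ij: "i \<le> j"
    have "[residue z j * f j = 1] (mod ?p ^ i)"
      using zf by (rule cong_dvd_modulus) (use ij in \<open>simp add: le_imp_power_dvd\<close>)
    moreover have "[residue z j = residue z i] (mod ?p ^ i)"
      using ij by (simp add: cong_def residue_mod residue_self_mod)
    ultimately have "[residue z i * f j = 1] (mod ?p ^ i)"
      by (metis cong_scalar_right cong_sym cong_trans)
    then have "[f i * (residue z i * f j) = f i * 1] (mod ?p ^ i)"
      by (rule cong_scalar_left)
    moreover have "[(residue z i * f i) * f j = 1 * f j] (mod ?p ^ i)"
      using zf by (rule cong_scalar_right)
    ultimately have "[f j = f i] (mod ?p ^ i)"
      by (metis cong_sym cong_trans mult.assoc mult.commute mult_1)
    then show "f j mod ?p ^ i = f i"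
      by (simp add: cong_def f_def)
  qed
  have "z * Abs_padic_int f = 1"
    using zf by (intro padic_int_eqI)
      (simp add: residue_mult Abs_padic_int_inverse[OF f] one_padic_int.rep_eq cong_def)
  then show ?thesis ..
qed

section \<open>Integral elements and their approximation by integers\<close>

lemma padic_of_int_diff: "padic_of_int (a - b) = padic_of_int a - padic_of_int b"
  using padic_of_int_add[of a "- b"] by (simp add: padic_of_int_minus)

lemma padic_of_int_0 [simp]: "padic_of_int 0 = 0"
  by (simp only: padic_of_int_eq_0_iff)

lemma padic_of_int_of_nat [simp]: "padic_of_int (of_nat n) = of_nat n"
  by (induction n) (simp_all add: padic_of_int_add padic_of_int_1)

lemma padic_of_int_of_int [simp]: "padic_of_int (of_int n) = of_int n"
  by (cases n rule: int_cases2) (simp_all add: padic_of_int_minus)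

abbreviation padic_p :: "'p::prime_card padic" where
  "padic_p \<equiv> of_nat CARD('p)"

lemma of_int_padic_eq_0_iff: "(of_int n :: 'p::prime_card padic) = 0 \<longleftrightarrow> n = 0"
proof
  assume "(of_int n :: 'p padic) = 0"
  then have "(of_int n :: 'p padic_int) = 0"
    by (metis padic_of_int_eq_0_iff padic_of_int_of_int)
  then have "n mod int CARD('p) ^ Suc (nat \<bar>n\<bar>) = 0"
    using residue_of_int[of n "Suc (nat \<bar>n\<bar>)", where 'p = 'p] by (simp add: zero_padic_int.rep_eq)
  then have dvd: "int CARD('p) ^ Suc (nat \<bar>n\<bar>) dvd n" by (simp add: dvd_eq_mod_eq_0)
  \<comment> \<open>A number divisible by a power of \<open>p\<close> larger than its absolute value
    is 0; the exponent \<open>\<bar>n\<bar> + 1\<close> is large enough.\<close>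
  have "Suc (nat \<bar>n\<bar>) < CARD('p) ^ Suc (nat \<bar>n\<bar>)"
    using prime_card[where 'a = 'p] by (intro power_gt_expt) (auto dest: prime_gt_1_nat)
  then have "int (Suc (nat \<bar>n\<bar>)) < int CARD('p) ^ Suc (nat \<bar>n\<bar>)"
    by (metis of_nat_less_iff of_nat_power)
  then have "\<bar>n\<bar> < int CARD('p) ^ Suc (nat \<bar>n\<bar>)"
    by linarith
  with dvd show "n = 0"
    using zdvd_imp_le[of "int CARD('p) ^ Suc (nat \<bar>n\<bar>)" "\<bar>n\<bar>"] by fastforce
qed simp

lemma padic_p_nonzero [simp]: "padic_p \<noteq> (0 :: 'p::prime_card padic)"
  using of_int_padic_eq_0_iff[of "int CARD('p)", where 'p = 'p] by simp

lemma padic_Ints_of_int [simp, intro]: "of_int n \<in> padic_Ints" "of_nat k \<in> padic_Ints"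
  by (simp_all add: padic_Ints_def flip: padic_of_int_of_int padic_of_int_of_nat)

lemma padic_Ints_0 [simp, intro]: "0 \<in> padic_Ints"
  using padic_Ints_of_int(1)[of 0] by simp

lemma padic_Ints_add [intro]: "x \<in> padic_Ints \<Longrightarrow> y \<in> padic_Ints \<Longrightarrow> x + y \<in> padic_Ints"
  by (auto simp: padic_Ints_def simp flip: padic_of_int_add)

lemma padic_Ints_diff [intro]: "x \<in> padic_Ints \<Longrightarrow> y \<in> padic_Ints \<Longrightarrow> x - y \<in> padic_Ints"
  by (auto simp: padic_Ints_def simp flip: padic_of_int_diff)

lemma padic_Ints_mult [intro]: "x \<in> padic_Ints \<Longrightarrow> y \<in> padic_Ints \<Longrightarrow> x * y \<in> padic_Ints"
  by (auto simp: padic_Ints_def simp flip: padic_of_int_mult)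

lemma padic_Ints_minus_iff: "- x \<in> padic_Ints \<longleftrightarrow> x \<in> padic_Ints"
  using padic_Ints_diff[OF padic_Ints_0, of x] padic_Ints_diff[OF padic_Ints_0, of "- x"] by auto

lemma padic_Ints_power [intro]: "x \<in> padic_Ints \<Longrightarrow> x ^ n \<in> padic_Ints"
  using padic_Ints_of_int(2)[of 1] by (induction n) auto

lemma padic_Ints_sum [intro]: "(\<And>i. i \<in> A \<Longrightarrow> f i \<in> padic_Ints) \<Longrightarrow> sum f A \<in> padic_Ints"
  by (induction A rule: infinite_finite_induct) auto

lemma padic_Ints_add_cancel: "x - y \<in> padic_Ints \<Longrightarrow> x \<in> padic_Ints \<longleftrightarrow> y \<in> padic_Ints"
  using padic_Ints_diff[of x "x - y"] padic_Ints_add[of "x - y" y] by auto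

text \<open>This is the dictionary between p-adic integrality and the divisibility conditions of the
  exponential sums.\<close>

lemma of_int_div_power_Ints_iff:
  "of_int n / padic_p ^ r \<in> (padic_Ints :: 'p::prime_card padic set) \<longleftrightarrow> int CARD('p) ^ r dvd n"
proof
  assume "of_int n / padic_p ^ r \<in> (padic_Ints :: 'p padic set)"
  then obtain w :: "'p padic_int" where "of_int n / padic_p ^ r = padic_of_int w"
    by (auto simp: padic_Ints_def)
  then have "padic_of_int (of_int n) = padic_of_int (of_nat (CARD('p) ^ r) * w)"
    by (simp only: padic_of_int_mult padic_of_int_of_int padic_of_int_of_nat) (simp add: field_simps)
  then have "of_int n = of_nat (CARD('p) ^ r) * w"
    by (simp only: padic_of_int_eq_iff)
  then have "residue (of_int n :: 'p padic_int) r = 0"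
    by (simp add: residue_mult residue_of_nat del: of_nat_power) simp
  then show "int CARD('p) ^ r dvd n"
    by (simp add: residue_of_int dvd_eq_mod_eq_0)
next
  assume "int CARD('p) ^ r dvd n"
  then obtain c where "n = int CARD('p) ^ r * c" ..
  then show "of_int n / padic_p ^ r \<in> (padic_Ints :: 'p padic set)"
    by simp
qed

text \<open>The integer is the residue of \<open>z\<close> at level \<open>r\<close>: the difference
  has residue 0 there and is divisible by \<open>p ^ r\<close>.\<close>

lemma padic_Ints_approx:
  assumes "z \<in> (padic_Ints :: 'p::prime_card padic set)"
  shows "\<exists>n. 0 \<le> n \<and> n < int CARD('p) ^ r \<and> (z - of_int n) / padic_p ^ r \<in> padic_Ints"
proof -
  obtain w where w: "z = padic_of_int w"
    using assms by (auto simp: padic_Ints_def)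
  have "residue (w - of_int (residue w r)) r = 0"
    by (simp add: residue_diff residue_of_int residue_self_mod)
  then obtain u where "w - of_int (residue w r) = of_nat CARD('p) ^ r * u"
    using residue_eq_0_imp_dvd by blast
  then have "padic_of_int (w - of_int (residue w r)) = padic_of_int (of_nat (CARD('p) ^ r) * u)"
    by simp
  then have "z - of_int (residue w r) = padic_p ^ r * padic_of_int u"
    unfolding padic_of_int_mult padic_of_int_diff padic_of_int_of_nat by (simp add: w)
  then have "(z - of_int (residue w r)) / padic_p ^ r \<in> padic_Ints"
    by (simp add: padic_Ints_def)
  moreover have "0 \<le> residue w r" "residue w r < int CARD('p) ^ r"
    using residue_self_mod[of w r] card_int_gt_1[where 'p = 'p]
    by (metis pos_mod_bound pos_mod_sign zero_less_power less_trans zero_less_one)+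
  ultimately show ?thesis by blast
qed

section \<open>Valuation and topology\<close>

lemma padic_val_mult: "padic_val (x * y) = padic_val x + padic_val y"
proof (cases "x = 0 \<or> y = 0")
  case True
  then show ?thesis by (cases "padic_val x"; cases "padic_val y") (auto simp: padic_val_def)
next
  case False
  obtain a b where x: "b \<noteq> 0" "x = padic_of_int a / padic_of_int b"
    by (rule padic_cases)
  obtain c d where y: "d \<noteq> 0" "y = padic_of_int c / padic_of_int d"
    by (rule padic_cases)
  have "x * y = padic_of_int (a * c) / padic_of_int (b * d)"
    by (simp add: x y padic_of_int_mult)
  moreover have "a \<noteq> 0" "c \<noteq> 0" using False x y by auto
  ultimately show ?thesis
    using x y by (simp add: padic_val_quot padic_int_val_mult)
qed

lemma padic_val_of_nat_card: "padic_val (padic_p :: 'p::prime_card padic) = Fin 1"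
proof -
  let ?z = "of_nat CARD('p) :: 'p padic_int"
  have z: "?z \<noteq> 0"
    by (metis padic_of_int_eq_0_iff padic_of_int_of_nat padic_p_nonzero)
  have p: "int CARD('p) > 1" by (rule card_int_gt_1)
  have "n \<le> padic_int_val ?z \<longleftrightarrow> n \<le> 1" for n
  proof -
    have "int CARD('p) ^ n dvd int CARD('p) ^ 1 \<longleftrightarrow> n \<le> 1"
      using p power_dvd_imp_le[of "CARD('p)" n 1] le_imp_power_dvd[of n 1 "int CARD('p)"]
        of_nat_dvd_iff[of "CARD('p) ^ n" "CARD('p) ^ 1", where 'a = int] by auto
    then show ?thesis
      by (simp add: padic_int_val_iff[OF z] residue_of_nat dvd_eq_mod_eq_0)
  qed
  then have 1: "padic_int_val ?z = 1"
    by (metis order_antisym order_refl)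
  have o: "padic_int_val (1 :: 'p padic_int) = 0"
    using padic_int_val_mult[of "1 :: 'p padic_int" 1] by simp
  show ?thesis
    using padic_val_quot[OF z one_neq_zero] by (simp add: 1 o padic_of_int_1)
qed

lemma padic_val_1: "padic_val (1 :: 'p::prime_card padic) = Fin 0"
  using padic_val_mult[of "1 :: 'p padic" 1] padic_val_finite[of "1 :: 'p padic"] by auto

lemma padic_val_p_power: "padic_val (padic_p powi n :: 'p::prime_card padic) = Fin n"
proof -
  have nat: "padic_val (padic_p ^ k :: 'p padic) = Fin (int k)" for k
    by (induction k) (simp_all add: padic_val_1 padic_val_mult padic_val_of_nat_card)
  show ?thesis
  proof (cases "n \<ge> 0")
    case True
    then show ?thesis using nat[of "nat n"] by (simp add: power_int_def)
  next
    case False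
    have "(padic_p powi n :: 'p padic) * padic_p ^ nat (- n) = 1"
      using False by (simp add: power_int_def flip: power_mult_distrib)
    then have "padic_val (padic_p powi n :: 'p padic) + Fin (int (nat (- n))) = Fin 0"
      by (metis nat padic_val_1 padic_val_mult)
    then show ?thesis
      using False by (cases "padic_val (padic_p powi n :: 'p padic)") auto
  qed
qed

text \<open>In a quotient of nonnegative valuation, the power of \<open>p\<close> in the denominator
  cancels against the numerator. What is left of the denominator is a unit and can be
  inverted.\<close>

lemma padic_Ints_iff: "x \<in> (padic_Ints :: 'p::prime_card padic set) \<longleftrightarrow> Fin 0 \<le> padic_val x"
proof
  assume "x \<in> padic_Ints"
  then obtain a where a: "x = padic_of_int a" by (auto simp: padic_Ints_def)
  have o: "padic_int_val (1 :: 'p padic_int) = 0"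
    using padic_int_val_mult[of "1 :: 'p padic_int" 1] by simp
  show "Fin 0 \<le> padic_val x"
    using padic_val_quot[OF _ one_neq_zero, of a] a o by (cases "a = 0") (simp_all add: padic_of_int_1)
next
  assume val: "Fin 0 \<le> padic_val x"
  show "x \<in> padic_Ints"
  proof (cases "x = 0")
    case False
    obtain a b where x: "b \<noteq> 0" "x = padic_of_int a / padic_of_int b"
      by (rule padic_cases)
    have a: "a \<noteq> 0" using False x by auto
    define n where "n = padic_int_val b"
    have n: "n \<le> padic_int_val a"
      using val x a by (simp add: padic_val_quot n_def)
    obtain u where u: "b = of_nat CARD('p) ^ n * u"
      using padic_int_val_iff[OF x(1), of n] residue_eq_0_imp_dvd[of b n] by (auto simp: n_def)
    obtain a' where a': "a = of_nat CARD('p) ^ n * a'"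
      using padic_int_val_iff[OF a, of n] n residue_eq_0_imp_dvd[of a n] by auto
    have "residue u 1 \<noteq> 0"
    proof
      assume "residue u 1 = 0"
      then obtain u' where "u = of_nat CARD('p) ^ 1 * u'"
        using residue_eq_0_imp_dvd by blast
      then have "b = of_nat (CARD('p) ^ Suc n) * u'"
        using u by (simp add: mult_ac)
      then have "residue b (Suc n) = 0"
        by (simp add: residue_mult residue_of_nat del: of_nat_power power_Suc) (simp del: power_Suc)
      then show False
        using padic_int_val_iff[OF x(1), of "Suc n"] by (simp add: n_def)
    qed
    then obtain w where w: "u * w = 1" using padic_int_unit_inverse by blast
    have "padic_of_int b * padic_of_int (a' * w) = padic_of_int (of_nat CARD('p) ^ n * a' * (u * w))"
      unfolding padic_of_int_mult[symmetric] u by (simp only: mult_ac)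
    also have "\<dots> = padic_of_int a" by (simp add: w a')
    finally have "x = padic_of_int (a' * w)"
      using x by (metis nonzero_mult_div_cancel_left padic_of_int_eq_0_iff)
    then show ?thesis by (simp add: padic_Ints_def)
  qed simp
qed

text \<open>Valuation bounds are used in this form throughout, because minima of valuations then
  become conjunctions of integrality conditions.\<close>

lemma padic_val_ge_iff: "Fin j \<le> padic_val x \<longleftrightarrow> padic_p powi (- j) * x \<in> (padic_Ints :: 'p::prime_card padic set)"
  by (cases "padic_val x") (auto simp: padic_Ints_iff padic_val_mult padic_val_p_power)

lemma open_padic_Ints: "open (padic_Ints :: 'p::prime_card padic set)"
  unfolding open_dist
proof (intro ballI exI[of _ 1] conjI allI impI)
  fix x y :: "'p padic" assume x: "x \<in> padic_Ints" and y: "dist y x < 1"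
  have "Fin 0 \<le> padic_val (y - x)"
  proof (cases "padic_val (y - x)")
    case (Fin k)
    have "real CARD('p) powi (- k) < 1"
      using y Fin by (simp add: dist_padic_def padic_norm_def)
    then have "\<not> - k \<ge> 0"
      using one_le_power_int[of "real CARD('p)" "- k"] card_gt_1[where 'p = 'p] by fastforce
    then show ?thesis using Fin by simp
  qed (auto simp: padic_val_def split: if_splits)
  then have "y - x \<in> padic_Ints" by (simp add: padic_Ints_iff)
  then show "y \<in> padic_Ints" using x padic_Ints_add_cancel by blast
qed simp

lemma continuous_on_padic_translation: "continuous_on UNIV ((+) (a :: 'p::prime_card padic))"
  by (auto simp: continuous_on_iff dist_padic_def intro!: exI)

section \<open>Characters of conductor \<open>\<int>\<^sub>p\<close>\<close>

context
  fixes \<psi> :: "'p::prime_card padic \<Rightarrow> complex"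
  assumes psi: "unitary_character \<psi>" "conductor_padic_Ints \<psi>"
begin

lemma character_add: "\<psi> (x + y) = \<psi> x * \<psi> y"
  using psi(1) by (simp add: unitary_character_def)

lemma character_Ints: "x \<in> padic_Ints \<Longrightarrow> \<psi> x = 1"
  using psi(2)[unfolded conductor_padic_Ints_def, rule_format, of 0] by simp

lemma character_cong: "x - y \<in> padic_Ints \<Longrightarrow> \<psi> x = \<psi> y"
  using character_add[of "x - y" y] character_Ints[of "x - y"] by simp

lemma character_of_int_mult:
  assumes "\<psi> z = 1"
  shows "\<psi> (of_int a * z) = 1"
proof -
  have 0: "\<psi> 0 = 1" by (rule character_Ints) simp
  have nat: "\<psi> (of_nat n * z) = 1" for n
    using assms by (induction n) (simp_all add: 0 distrib_right character_add)
  then show ?thesis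
    using character_add[of "of_int a * z" "- (of_int a * z)"] nat[of "nat \<bar>a\<bar>"]
    by (cases a rule: int_cases2) (simp_all add: 0)
qed

lemma character_nontrivial: "\<exists>z\<in>padic_Ints. \<psi> (z / padic_p) \<noteq> 1"
  using psi(2)[unfolded conductor_padic_Ints_def, rule_format, of "-1"]
  by (auto simp: power_int_def divide_inverse mult.commute)

text \<open>Suppose \<open>n / p ^ r\<close> were in the kernel with \<open>p ^ r\<close> not
  dividing \<open>n\<close>. By Bezout the kernel contains \<open>g / p ^ r\<close>, where the gcd
  \<open>g\<close> is \<open>p ^ i\<close> with \<open>i < r\<close>, hence also
  \<open>1 / p\<close>. Integers represent all classes modulo \<open>p\<close>, so
  \<open>\<psi>\<close> would be trivial on \<open>padic_Ints\<close> divided by \<open>p\<close>,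
  against the conductor.\<close>

lemma character_primitive: "primitive_character CARD('p) r (\<lambda>n. \<psi> (of_int n / padic_p ^ r))"
proof
  show "prime CARD('p)" by (rule prime_card)
  show "\<psi> (of_int (x + y) / padic_p ^ r) = \<psi> (of_int x / padic_p ^ r) * \<psi> (of_int y / padic_p ^ r)" for x y
    by (simp add: add_divide_distrib character_add)
  show "\<psi> (of_int n / padic_p ^ r) = 1 \<longleftrightarrow> int CARD('p) ^ r dvd n" for n
  proof
    assume "int CARD('p) ^ r dvd n"
    then show "\<psi> (of_int n / padic_p ^ r) = 1"
      by (intro character_Ints) (simp add: of_int_div_power_Ints_iff)
  next
    assume n: "\<psi> (of_int n / padic_p ^ r) = 1"
    show "int CARD('p) ^ r dvd n"
    proof (rule ccontr)
      assume nd: "\<not> int CARD('p) ^ r dvd n"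
      define g where "g = gcd n (int CARD('p) ^ r)"
      obtain a b where ab: "a * n + b * int CARD('p) ^ r = g"
        unfolding g_def by (metis bezout_int)
      have "\<psi> (of_int (a * n) / padic_p ^ r) = 1"
        using character_of_int_mult[OF n, of a] by simp
      moreover have "\<psi> (of_int (b * int CARD('p) ^ r) / padic_p ^ r) = 1"
        by (intro character_Ints) simp
      ultimately have g1: "\<psi> (of_int g / padic_p ^ r) = 1"
        unfolding ab[symmetric] of_int_add add_divide_distrib character_add by simp
      have "g dvd int CARD('p) ^ r" "g \<ge> 0" by (simp_all add: g_def)
      then obtain i where i: "i \<le> r" "g = int CARD('p) ^ i"
        using divides_primepow[OF prime_card_int[where 'a = 'p], of g r] by auto
      have "i \<noteq> r"
        using nd i by (auto simp: g_def) (metis gcd_dvd1)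
      then have "i < r" using i by simp
      then have "r = Suc (r - 1)" "(padic_p :: 'p padic) ^ (r - 1) = padic_p ^ (r - 1 - i) * padic_p ^ i"
        by (simp_all flip: power_add)
      then have eq: "(padic_p :: 'p padic) ^ r = padic_p * (padic_p ^ (r - 1 - i) * padic_p ^ i)"
        by (metis power_Suc)
      have "of_int (int CARD('p) ^ (r - 1 - i)) * (of_int g / padic_p ^ r) = (1 / padic_p :: 'p padic)"
        by (simp add: i(2) eq)
      then have one: "\<psi> (1 / padic_p) = 1"
        using character_of_int_mult[OF g1] by metis
      obtain z where z: "z \<in> padic_Ints" "\<psi> (z / padic_p) \<noteq> 1"
        using character_nontrivial by blast
      obtain c where c: "(z - of_int c) / padic_p ^ 1 \<in> padic_Ints"
        using padic_Ints_approx[OF z(1), of 1] by blast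
      have "\<psi> (z / padic_p) = \<psi> (of_int c * (1 / padic_p))"
        using c by (intro character_cong) (simp add: diff_divide_distrib)
      then show False
        using z(2) character_of_int_mult[OF one] by simp
    qed
  qed
qed

end

section \<open>The quadratic lattice\<close>

text \<open>The coefficient of \<open>x\<^sub>i y\<^sub>i\<close> in the quadratic form.\<close>

definition weight :: "nat \<Rightarrow> 'm + 'm \<Rightarrow> nat" where
  "weight p = case_sum (\<lambda>_. 1) (\<lambda>_. p)"

lemma weight_simps [simp]: "weight p (Inl i) = 1" "weight p (Inr i) = p"
  by (simp_all add: weight_def)

lemma sum_UNIV_sum_type:
  "(\<Sum>i\<in>(UNIV :: ('a::finite + 'b::finite) set). f i) = (\<Sum>i\<in>UNIV. f (Inl i)) + (\<Sum>i\<in>UNIV. f (Inr i))"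
  by (simp add: sum.Plus flip: UNIV_Plus_UNIV)

lemma quad_form_weight:
  "quad_form (x, y :: ('p::prime_card padic, 'm::finite + 'm) vec) =
    (\<Sum>i\<in>UNIV. of_nat (weight CARD('p) i) * (x $ i * y $ i))"
  by (simp add: quad_form_def sum_UNIV_sum_type sum_distrib_left)

lemma bilin_form_weight:
  "bilin_form (a, b) (x, y :: ('p::prime_card padic, 'm::finite + 'm) vec) =
    (\<Sum>i\<in>UNIV. of_nat (weight CARD('p) i) * (a $ i * y $ i + b $ i * x $ i))"
  by (simp add: bilin_form_def quad_form_weight algebra_simps flip: sum.distrib sum_subtractf)

lemma bilin_form_add_right: "bilin_form u (v + w) = bilin_form u v + bilin_form u (w :: ('p::prime_card, 'm::finite) quad_space)"
  by (cases u; cases v; cases w) (simp add: bilin_form_weight algebra_simps flip: sum.distrib)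

lemma quad_form_add: "quad_form (u + v) = quad_form u + bilin_form u v + quad_form v"
  by (simp add: bilin_form_def)

lemma le_vector_val_iff:
  "Fin j \<le> vector_val (a, b :: ('p::prime_card padic, 'm::finite) vec) \<longleftrightarrow>
    (\<forall>i. padic_p powi (- j) * a $ i \<in> padic_Ints \<and> padic_p powi (- j) * b $ i \<in> padic_Ints)"
  by (simp add: vector_val_def ball_Un padic_val_ge_iff all_conj_distrib)

lemma le_min_val_iff:
  "Fin j \<le> min (vector_val (part1 (a, b))) (vector_val (part2 (a, b :: ('p::prime_card padic, 'm::finite + 'm) vec))) \<longleftrightarrow>
    (\<forall>i. padic_p powi (- j) * a $ i \<in> padic_Ints \<and> padic_p powi (- j) * b $ i \<in> padic_Ints)"
  by (auto simp: part1_def part2_def le_vector_val_iff split_sum_all)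

lemma extended_le_add_one_iff: "Fin j \<le> x + 1 \<longleftrightarrow> Fin (j - 1) \<le> (x :: int extended)"
  by (cases x) (auto simp: one_extended_def)

text \<open>Shifting the valuation of the second block by 1 is multiplying its coordinates by
  \<open>p\<close>. So \<open>k2\<close> is the least valuation of the weighted coordinates, and
  \<open>k2 \<ge> 0\<close> says that the vector lies in the dual lattice.\<close>

lemma le_min_val_weight_iff:
  "Fin j \<le> min (vector_val (part1 (a, b)))
      (vector_val (part2 (a, b :: ('p::prime_card padic, 'm::finite + 'm) vec)) + 1) \<longleftrightarrow>
    (\<forall>i. padic_p powi (- j) * (of_nat (weight CARD('p) i) * a $ i) \<in> padic_Ints \<and>
      padic_p powi (- j) * (of_nat (weight CARD('p) i) * b $ i) \<in> padic_Ints)"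
proof -
  have "padic_p powi (1 - j) = padic_p powi (- j) * (padic_p :: 'p padic)"
    by (simp add: power_int_diff power_int_minus field_simps)
  then show ?thesis
    by (auto simp: mult.assoc part1_def part2_def extended_le_add_one_iff le_vector_val_iff split_sum_all)
qed

section \<open>Haar measure on the quadratic space\<close>

lemma continuous_on_translation:
  "continuous_on UNIV ((+) (l :: ('p::prime_card, 'm::finite) quad_space))"
proof -
  have vec: "continuous_on UNIV (\<lambda>u. g u + a)" if "continuous_on UNIV g"
    for g :: "('p, 'm) quad_space \<Rightarrow> ('p padic, 'm + 'm) vec" and a
  proof -
    have "continuous_on UNIV (\<lambda>u. \<chi> i. a $ i + g u $ i)"
      by (intro continuous_on_vec_lambda continuous_on_compose2[OF continuous_on_padic_translation]
          continuous_on_component that) auto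
    also have "(\<lambda>u. \<chi> i. a $ i + g u $ i) = (\<lambda>u. g u + a)"
      by (auto simp: fun_eq_iff vec_eq_iff)
    finally show ?thesis .
  qed
  have "continuous_on UNIV (\<lambda>u. (fst u + fst l, snd u + snd l))"
    by (intro continuous_on_Pair vec continuous_on_fst continuous_on_snd continuous_on_id)
  also have "(\<lambda>u. (fst u + fst l, snd u + snd l)) = (+) l"
    by (auto simp: fun_eq_iff plus_prod_def add.commute)
  finally show ?thesis .
qed

lemma open_lattice_L: "open (lattice_L :: ('p::prime_card, 'm::finite) quad_space set)"
proof -
  have "lattice_L = (\<Inter>i. (\<lambda>u :: ('p, 'm) quad_space. fst u $ i) -` padic_Ints \<inter> (\<lambda>u. snd u $ i) -` padic_Ints)"
    by (auto simp: lattice_L_def)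
  moreover have "open \<dots>"
    by (intro open_INT open_Int open_vimage open_padic_Ints ballI continuous_on_component
        continuous_on_fst continuous_on_snd continuous_on_id) auto
  ultimately show ?thesis by simp
qed

lemma mem_scaled_lattice_iff:
  "(x, y) \<in> quad_scale (padic_p powi (- int r)) ` (lattice_L :: ('p::prime_card, 'm::finite) quad_space set) \<longleftrightarrow>
    (\<forall>i. padic_p ^ r * x $ i \<in> padic_Ints \<and> padic_p ^ r * y $ i \<in> padic_Ints)"
    (is "?l \<longleftrightarrow> ?r")
proof
  assume ?l
  then show ?r
    by (auto simp: quad_scale_def lattice_L_def power_int_minus power_int_of_nat field_simps)
next
  assume ?r
  then have "(padic_p ^ r *s x, padic_p ^ r *s y) \<in> lattice_L"
    by (simp add: lattice_L_def)
  moreover have "(x, y) = quad_scale (padic_p powi (- int r)) (padic_p ^ r *s x, padic_p ^ r *s y)"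
    by (simp add: quad_scale_def vec_eq_iff power_int_minus)
  ultimately show ?l by (rule rev_image_eqI)
qed

lemma lattice_L_diff: "u \<in> lattice_L \<Longrightarrow> v \<in> lattice_L \<Longrightarrow> u - v \<in> lattice_L"
  by (cases u; cases v) (auto simp: lattice_L_def)

lemma lattice_subset_scaled:
  "lattice_L \<subseteq> quad_scale (padic_p powi (- int r)) ` (lattice_L :: ('p::prime_card, 'm::finite) quad_space set)"
  by (auto simp: mem_scaled_lattice_iff simp del: of_nat_power) (auto simp: lattice_L_def)

lemma scaled_lattice_add:
  assumes "u \<in> quad_scale (padic_p powi (- int r)) ` lattice_L"
    "v \<in> quad_scale (padic_p powi (- int r)) ` (lattice_L :: ('p::prime_card, 'm::finite) quad_space set)"
  shows "u + v \<in> quad_scale (padic_p powi (- int r)) ` lattice_L"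
  using assms by (cases u; cases v) (auto simp: mem_scaled_lattice_iff distrib_left)

lemma scaled_lattice_translate_iff:
  assumes "l \<in> quad_scale (padic_p powi (- int r)) ` (lattice_L :: ('p::prime_card, 'm::finite) quad_space set)"
  shows "l + u \<in> quad_scale (padic_p powi (- int r)) ` lattice_L \<longleftrightarrow>
    u \<in> quad_scale (padic_p powi (- int r)) ` lattice_L"
proof -
  have "- l \<in> quad_scale (padic_p powi (- int r)) ` lattice_L"
    using assms by (cases l) (simp add: mem_scaled_lattice_iff padic_Ints_minus_iff)
  from scaled_lattice_add[OF this, of "l + u"] scaled_lattice_add[OF assms, of u]
  show ?thesis by auto
qed

text \<open>Measurability of \<open>f\<close> is not an issue: the integral of a non-integrable function is 0.\<close>

lemma set_integral_eq_0_if_translate: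
  fixes f :: "('p::prime_card, 'm::finite) quad_space \<Rightarrow> complex"
  assumes mu: "haar_measure \<mu>"
    and S: "\<And>x. l + x \<in> S \<longleftrightarrow> x \<in> S"
    and f: "\<And>x. x \<in> S \<Longrightarrow> f (l + x) = c * f x" and c: "c \<noteq> 1"
  shows "(LINT x : S | \<mu>. f x) = 0"
proof -
  define g where "g = (\<lambda>x. indicator S x *\<^sub>R f x)"
  have "integral\<^sup>L \<mu> g = 0"
  proof (cases "integrable \<mu> g")
    case True
    have sets: "sets \<mu> = sets borel"
      using mu by (simp add: haar_measure_def)
    have meas: "(+) a \<in> measurable \<mu> \<mu>" for a
      using borel_measurable_continuous_onI[OF continuous_on_translation[of a]]
      by (simp add: measurable_cong_sets[OF sets sets])
    \<comment> \<open>Invariance in \<open>haar_measure\<close> is stated for images; the preimage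
      under translation by \<open>l\<close> is the image under translation by
      \<open>- l\<close>.\<close>
    have "distr \<mu> \<mu> ((+) l) = \<mu>"
    proof (rule measure_eqI)
      fix A assume "A \<in> sets (distr \<mu> \<mu> ((+) l))"
      then have A: "A \<in> sets \<mu>" by simp
      have "(+) l -` A \<inter> space \<mu> = (+) (- l) ` A"
        using sets_eq_imp_space_eq[OF sets] by (auto simp: image_iff intro!: bexI[of _ "l + _"])
      moreover have "emeasure \<mu> ((+) (- l) ` A) = emeasure \<mu> A"
        using A mu unfolding haar_measure_def by blast
      ultimately show "emeasure (distr \<mu> \<mu> ((+) l)) A = emeasure \<mu> A"
        using A by (simp add: emeasure_distr[OF meas])
    qed simp
    \<comment> \<open>Translation invariance gives an integral equal to \<open>c\<close> times
      itself.\<close>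
    then have "integral\<^sup>L \<mu> g = integral\<^sup>L \<mu> (\<lambda>x. g (l + x))"
      using integral_distr[OF meas borel_measurable_integrable[OF True], of l] by simp
    also have "(\<lambda>x. g (l + x)) = (\<lambda>x. c * g x)"
      by (auto simp: g_def S f indicator_def fun_eq_iff)
    finally show ?thesis using c by simp
  qed (rule not_integrable_integral_eq)
  then show ?thesis
    unfolding set_lebesgue_integral_def g_def .
qed

text \<open>For \<open>F\<close> with entries in \<open>{0..<p\<^sup>r}\<close>, these represent \<open>p\<^bsup>-r\<^esup> L\<close> modulo \<open>L\<close>.\<close>

definition lattice_point :: "nat \<Rightarrow> ('m + 'm \<Rightarrow> int \<times> int) \<Rightarrow> ('p::prime_card, 'm::finite) quad_space" where
  "lattice_point r F = (\<chi> i. of_int (fst (F i)) / padic_p ^ r, \<chi> i. of_int (snd (F i)) / padic_p ^ r)"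

lemma lattice_point_diff_iff:
  "lattice_point r F - lattice_point r G \<in> (lattice_L :: ('p::prime_card, 'm::finite) quad_space set) \<longleftrightarrow>
    (\<forall>i. [fst (F i) = fst (G i)] (mod int CARD('p) ^ r) \<and> [snd (F i) = snd (G i)] (mod int CARD('p) ^ r))"
  by (simp add: lattice_point_def lattice_L_def cong_iff_dvd_diff of_int_div_power_Ints_iff
      flip: diff_divide_distrib of_int_diff)

lemma lattice_point_inj:
  assumes "F \<in> point_indices (int CARD('p) ^ r)" "G \<in> point_indices (int CARD('p) ^ r)"
    and "lattice_point r F - lattice_point r G \<in> (lattice_L :: ('p::prime_card, 'm::finite) quad_space set)"
  shows "F = G"
proof
  fix i
  have "F i \<in> {0..<int CARD('p) ^ r} \<times> {0..<int CARD('p) ^ r}" "G i \<in> {0..<int CARD('p) ^ r} \<times> {0..<int CARD('p) ^ r}"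
    using assms(1,2) by (auto simp: point_indices_def PiE_def Pi_def)
  moreover have "[fst (F i) = fst (G i)] (mod int CARD('p) ^ r)" "[snd (F i) = snd (G i)] (mod int CARD('p) ^ r)"
    using assms(3) by (simp_all add: lattice_point_diff_iff)
  ultimately show "F i = G i"
    by (cases "F i"; cases "G i") (auto simp: cong_def)
qed

lemma lattice_point_mem: "lattice_point r F \<in> quad_scale (padic_p powi (- int r)) ` lattice_L"
  by (simp add: lattice_point_def mem_scaled_lattice_iff)

lemma lattice_point_exists:
  fixes x :: "('p::prime_card, 'm::finite) quad_space"
  assumes "x \<in> quad_scale (padic_p powi (- int r)) ` lattice_L"
  shows "\<exists>F\<in>point_indices (int CARD('p) ^ r). x - lattice_point r F \<in> lattice_L"
proof -
  obtain a b where x: "x = (a, b)" by (cases x)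
  have approx: "\<exists>n\<in>{0..<int CARD('p) ^ r}. z - of_int n / padic_p ^ r \<in> padic_Ints"
    if z: "padic_p ^ r * z \<in> padic_Ints" for z :: "'p padic"
    using padic_Ints_approx[OF z, of r] by (force simp: diff_divide_distrib)
  have "\<forall>i. \<exists>n\<in>{0..<int CARD('p) ^ r}. a $ i - of_int n / padic_p ^ r \<in> padic_Ints"
    "\<forall>i. \<exists>n\<in>{0..<int CARD('p) ^ r}. b $ i - of_int n / padic_p ^ r \<in> padic_Ints"
    using assms approx unfolding x mem_scaled_lattice_iff by blast+
  then obtain A B where AB: "\<And>i. A i \<in> {0..<int CARD('p) ^ r} \<and> a $ i - of_int (A i) / padic_p ^ r \<in> padic_Ints"
    "\<And>i. B i \<in> {0..<int CARD('p) ^ r} \<and> b $ i - of_int (B i) / padic_p ^ r \<in> padic_Ints"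
    by metis
  show ?thesis
    using AB by (intro bexI[of _ "\<lambda>i. (A i, B i)"])
      (auto simp: x lattice_point_def lattice_L_def point_indices_def)
qed

lemma add_diff_self: "b + (a - b) = (a :: 'a::ab_group_add)"
  by simp

lemma diff_diff_diff_cancel_left: "(a - b) - (a - c) = c - (b :: 'a::ab_group_add)"
  by simp

text \<open>The domain is the disjoint union of finitely many cosets of \<open>lattice_L\<close>,
  each of volume 1, and \<open>f\<close> is constant on each, so the integrand is a step
  function.\<close>

lemma set_integral_lattice_invariant:
  fixes f :: "('p::prime_card, 'm::finite) quad_space \<Rightarrow> complex"
  assumes mu: "haar_measure \<mu>" "emeasure \<mu> lattice_L = 1"
    and f: "\<And>x l. x \<in> quad_scale (padic_p powi (- int r)) ` lattice_L \<Longrightarrow> l \<in> lattice_L \<Longrightarrow> f (x + l) = f x"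
  shows "(LINT x : quad_scale (padic_p powi (- int r)) ` lattice_L | \<mu>. f x) =
    (\<Sum>F\<in>point_indices (int CARD('p) ^ r). f (lattice_point r F))"
proof -
  define S where "S = quad_scale (padic_p powi (- int r)) ` (lattice_L :: ('p, 'm) quad_space set)"
  let ?I = "point_indices (int CARD('p) ^ r) :: ('m + 'm \<Rightarrow> int \<times> int) set"
  define coset :: "('m + 'm \<Rightarrow> int \<times> int) \<Rightarrow> ('p, 'm) quad_space set" where
    "coset F = (+) (lattice_point r F) ` lattice_L" for F
  have mem: "x \<in> coset F \<longleftrightarrow> x - lattice_point r F \<in> lattice_L" for x F
  proof
    show "x \<in> coset F" if "x - lattice_point r F \<in> lattice_L"
      using imageI[OF that, of "(+) (lattice_point r F)"] by (simp only: coset_def add_diff_self)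
    show "x - lattice_point r F \<in> lattice_L" if "x \<in> coset F"
      using that unfolding coset_def by (elim imageE) (simp only: add_diff_cancel_left')
  qed
  have eq: "indicator S x *\<^sub>R f x = (\<Sum>F\<in>?I. indicator (coset F) x *\<^sub>R f (lattice_point r F))" for x
  proof (cases "x \<in> S")
    case True
    obtain F where F: "F \<in> ?I" "x - lattice_point r F \<in> lattice_L"
      using lattice_point_exists[OF True[unfolded S_def]] by blast
    have "x \<in> coset G \<longleftrightarrow> G = F" if "G \<in> ?I" for G
    proof
      assume "x \<in> coset G"
      then have "(x - lattice_point r F) - (x - lattice_point r G) \<in> lattice_L"
        unfolding mem by (rule lattice_L_diff[OF F(2)])
      moreover have "(x - lattice_point r F) - (x - lattice_point r G) = lattice_point r G - lattice_point r F"
        by (rule diff_diff_diff_cancel_left)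
      ultimately show "G = F"
        by (intro lattice_point_inj[OF that F(1)]) (simp only:)
    next
      assume "G = F"
      then show "x \<in> coset G" using F(2) mem by (simp only:)
    qed
    then have "(\<Sum>G\<in>?I. indicator (coset G) x *\<^sub>R f (lattice_point r G)) =
        (\<Sum>G\<in>?I. if G = F then f (lattice_point r G) else 0)"
      by (intro sum.cong refl) (simp add: indicator_def)
    also have "\<dots> = f (lattice_point r F)" using F(1) by (simp add: sum.delta)
    also have "f (lattice_point r F) = f x"
      using f[OF lattice_point_mem[of r F] F(2)] unfolding add_diff_self by (rule sym)
    finally have "(\<Sum>G\<in>?I. indicator (coset G) x *\<^sub>R f (lattice_point r G)) = f x" .
    then show ?thesis using True by (simp only: indicator_simps scaleR_one)
  next
    case False
    have "x \<notin> coset F" for F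
    proof
      assume "x \<in> coset F"
      then have "x - lattice_point r F \<in> S"
        unfolding S_def mem by (rule subsetD[OF lattice_subset_scaled])
      from scaled_lattice_add[OF lattice_point_mem[of r F] this[unfolded S_def]] have "x \<in> S"
        by (simp only: S_def add_diff_self)
      with False show False by contradiction
    qed
    with False show ?thesis by simp
  qed
  have sets: "sets \<mu> = sets borel" using mu by (simp add: haar_measure_def)
  have L: "lattice_L \<in> sets \<mu>" unfolding sets by (rule borel_open) (rule open_lattice_L)
  have translate: "emeasure \<mu> ((+) a ` A) = emeasure \<mu> A" if "A \<in> sets borel" for a A
    using mu(1) that unfolding haar_measure_def by blast
  have bochner: "has_bochner_integral \<mu> (\<lambda>x. indicator (coset F) x *\<^sub>R f (lattice_point r F)) (f (lattice_point r F))" for F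
  proof -
    have "coset F = (+) (- lattice_point r F) -` lattice_L"
      by (auto simp: mem)
    moreover have "open \<dots>"
      by (intro open_vimage open_lattice_L continuous_on_translation)
    ultimately have "coset F \<in> sets \<mu>" unfolding sets by (intro borel_open) (simp only:)
    moreover have e: "emeasure \<mu> (coset F) = 1"
      using mu(2) translate L by (simp only: coset_def sets)
    ultimately show ?thesis
      using has_bochner_integral_indicator[of "coset F" \<mu> "f (lattice_point r F)"]
      by (simp add: measure_def)
  qed
  show ?thesis
    unfolding S_def[symmetric] set_lebesgue_integral_def eq
    by (intro has_bochner_integral_integral_eq has_bochner_integral_sum bochner)
qed

section \<open>The coefficients\<close>

lemma bilin_form_scaled_Ints:
  assumes "x \<in> quad_scale (padic_p powi (- int r)) ` lattice_L" "l \<in> (lattice_L :: ('p::prime_card, 'm::finite) quad_space set)"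
  shows "padic_p ^ r * bilin_form x l \<in> padic_Ints"
proof -
  obtain a b c d where x: "x = (a, b)" and l: "l = (c, d)" by (cases x; cases l)
  have "padic_p ^ r * bilin_form x l =
      (\<Sum>i\<in>UNIV. of_nat (weight CARD('p) i) * ((padic_p ^ r * a $ i) * d $ i + (padic_p ^ r * b $ i) * c $ i))"
    by (simp add: x l bilin_form_weight sum_distrib_left algebra_simps)
  also have "\<dots> \<in> padic_Ints"
  proof (intro padic_Ints_sum padic_Ints_mult[OF padic_Ints_of_int(2)] padic_Ints_add)
    fix i
    show "padic_p ^ r * a $ i * d $ i \<in> padic_Ints" "padic_p ^ r * b $ i * c $ i \<in> padic_Ints"
      using assms padic_Ints_mult[of "padic_p ^ r * a $ i" "d $ i"] padic_Ints_mult[of "padic_p ^ r * b $ i" "c $ i"]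
      unfolding x l mem_scaled_lattice_iff by (simp_all add: lattice_L_def)
  qed
  finally show ?thesis .
qed

lemma quad_form_Ints: "l \<in> lattice_L \<Longrightarrow> quad_form l \<in> padic_Ints"
  by (cases l) (auto simp: lattice_L_def quad_form_weight)

lemma quad_form_translate_Ints_iff:
  assumes "padic_p ^ r * bilin_form x l \<in> padic_Ints" "padic_p ^ r * quad_form l \<in> padic_Ints"
  shows "padic_p ^ r * quad_form (x + l) \<in> padic_Ints \<longleftrightarrow>
    padic_p ^ r * quad_form (x :: ('p::prime_card, 'm::finite) quad_space) \<in> padic_Ints"
proof (rule padic_Ints_add_cancel)
  have "padic_p ^ r * quad_form (x + l) - padic_p ^ r * quad_form x =
      padic_p ^ r * bilin_form x l + padic_p ^ r * quad_form l"
    unfolding quad_form_add by (simp add: algebra_simps)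
  then show "padic_p ^ r * quad_form (x + l) - padic_p ^ r * quad_form x \<in> padic_Ints"
    using padic_Ints_add[OF assms] by (simp only:)
qed

section \<open>Vanishing of the coefficients outside the lattice\<close>

context
  fixes \<psi> :: "'p::prime_card padic \<Rightarrow> complex" and \<mu> :: "('p, 'm::finite) quad_space measure"
  assumes psi: "unitary_character \<psi>" "conductor_padic_Ints \<psi>" and mu: "haar_measure \<mu>"
begin

lemma character_detects_Ints:
  assumes "z \<notin> padic_Ints"
  shows "\<exists>w\<in>padic_Ints. \<psi> (w * z) \<noteq> 1"
proof -
  obtain y where y: "y \<in> padic_Ints" "\<psi> (y / padic_p) \<noteq> 1"
    using character_nontrivial[OF psi] by blast
  have z: "z \<noteq> 0" using assms by auto
  obtain n where n: "padic_val z = Fin n" using padic_val_finite[OF z] ..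
  then have "n < 0" using assms by (simp add: padic_Ints_iff)
  \<comment> \<open>Since \<open>z\<close> has negative valuation, \<open>padic_p * z\<close> has
    valuation at most 0, so \<open>w\<close> is integral, while \<open>w * z\<close> is a point
    where \<open>\<psi>\<close> is not 1.\<close>
  define w where "w = y / (padic_p * z)"
  have "y = w * (padic_p * z)" using z by (simp add: w_def)
  then have "padic_val y = padic_val w + (Fin 1 + Fin n)"
    by (simp add: padic_val_mult padic_val_of_nat_card n)
  then have "w \<in> padic_Ints"
    using y(1) \<open>n < 0\<close> unfolding padic_Ints_iff by (cases "padic_val w") auto
  moreover have "w * z = y / padic_p" using z by (simp add: w_def)
  ultimately show ?thesis using y(2) by (intro bexI[of _ w]) simp_all
qed

text \<open>The hypotheses on \<open>l\<close> make both conditions in the integrand invariant under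
  translation by \<open>l\<close>, while the character picks up the factor
  \<open>\<psi> (bilin_form \<eta> l)\<close>.\<close>

lemma C_coeff_eq_0:
  assumes l: "l \<in> quad_scale (padic_p powi (- int r)) ` lattice_L"
    and bilin: "\<And>x. x \<in> quad_scale (padic_p powi (- int r)) ` lattice_L \<Longrightarrow> padic_p ^ r * bilin_form x l \<in> padic_Ints"
    and quad: "padic_p ^ r * quad_form l \<in> padic_Ints" and \<eta>: "\<psi> (bilin_form \<eta> l) \<noteq> 1"
  shows "C_coeff \<mu> \<psi> r \<eta> = 0"
  unfolding C_coeff_def
proof (rule set_integral_eq_0_if_translate[OF mu scaled_lattice_translate_iff[OF l] _ \<eta>])
  fix x :: "('p, 'm) quad_space" assume x: "x \<in> quad_scale (padic_p powi (- int r)) ` lattice_L"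
  show "\<psi> (bilin_form \<eta> (l + x)) * of_bool (padic_p ^ r * quad_form (l + x) \<in> padic_Ints) =
      \<psi> (bilin_form \<eta> l) * (\<psi> (bilin_form \<eta> x) * of_bool (padic_p ^ r * quad_form x \<in> padic_Ints))"
    using quad_form_translate_Ints_iff[OF bilin[OF x] quad]
    by (simp only: bilin_form_add_right character_add[OF psi] add.commute[of l] mult.assoc mult.left_commute)
qed

text \<open>Translation is by \<open>c\<close> times a standard basis vector. It is isotropic, and
  its pairing with a vector isolates one weighted coordinate; the first condition on
  \<open>c\<close> puts it in the scaled lattice, the second keeps its pairings under
  control.\<close>

lemma C_coeff_eq_0_coordinate:
  fixes a b :: "('p padic, 'm + 'm) vec"
  assumes c: "padic_p ^ r * c \<in> padic_Ints" "of_nat (weight CARD('p) i) * c \<in> padic_Ints"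
    and \<psi>: "\<psi> (of_nat (weight CARD('p) i) * a $ i * c) \<noteq> 1 \<or> \<psi> (of_nat (weight CARD('p) i) * b $ i * c) \<noteq> 1"
  shows "C_coeff \<mu> \<psi> r (a, b) = 0"
proof -
  have axis: "(\<Sum>j\<in>UNIV. of_nat (weight CARD('p) j) * (u $ j * axis i c $ j)) = of_nat (weight CARD('p) i) * u $ i * c"
    for u :: "('p padic, 'm + 'm) vec"
  proof -
    have "(\<Sum>j\<in>UNIV. of_nat (weight CARD('p) j) * (u $ j * axis i c $ j)) =
        (\<Sum>j\<in>UNIV. if j = i then of_nat (weight CARD('p) i) * u $ i * c else 0)"
      by (intro sum.cong) (auto simp: axis_def)
    then show ?thesis by simp
  qed
  have "bilin_form (u, v) (axis i c, 0) = of_nat (weight CARD('p) i) * v $ i * c"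
    "bilin_form (u, v) (0, axis i c) = of_nat (weight CARD('p) i) * u $ i * c" for u v
    using axis[of u] axis[of v] by (simp_all add: bilin_form_weight)
  note bilin = this
  have "\<exists>l\<in>{(axis i c, 0), (0, axis i c)}. \<psi> (bilin_form (a, b) l) \<noteq> 1"
    using \<psi> by (auto simp only: bex_simps bilin)
  then obtain l where l: "l \<in> {(axis i c, 0), (0, axis i c)}" and \<psi>l: "\<psi> (bilin_form (a, b) l) \<noteq> 1"
    by (elim bexE)
  show ?thesis
  proof (rule C_coeff_eq_0[OF _ _ _ \<psi>l])
    show "l \<in> quad_scale (padic_p powi (- int r)) ` lattice_L"
      using l c by (auto simp: mem_scaled_lattice_iff axis_def)
    show "padic_p ^ r * quad_form l \<in> padic_Ints"
      using l by (auto simp: quad_form_weight)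
    fix x :: "('p, 'm) quad_space" assume "x \<in> quad_scale (padic_p powi (- int r)) ` lattice_L"
    then have "(fst x, snd x) \<in> quad_scale (padic_p powi (- int r)) ` lattice_L"
      by simp
    then have x: "padic_p ^ r * fst x $ i \<in> padic_Ints" "padic_p ^ r * snd x $ i \<in> padic_Ints"
      unfolding mem_scaled_lattice_iff by blast+
    have "bilin_form x l \<in> {of_nat (weight CARD('p) i) * fst x $ i * c, of_nat (weight CARD('p) i) * snd x $ i * c}"
      using l bilin[of "fst x" "snd x"] by auto
    then have "padic_p ^ r * bilin_form x l \<in>
        {(of_nat (weight CARD('p) i) * c) * (padic_p ^ r * fst x $ i), (of_nat (weight CARD('p) i) * c) * (padic_p ^ r * snd x $ i)}"
      by (auto simp: mult_ac)
    then show "padic_p ^ r * bilin_form x l \<in> padic_Ints"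
      using padic_Ints_mult[OF c(2) x(1)] padic_Ints_mult[OF c(2) x(2)]
      by (elim insertE emptyE) (simp_all only:)
  qed
qed

lemma C_coeff_eq_0_if_not_dual:
  assumes "of_nat (weight CARD('p) i) * a $ i \<notin> padic_Ints \<or> of_nat (weight CARD('p) i) * b $ i \<notin> padic_Ints"
  shows "C_coeff \<mu> \<psi> r (a, b) = 0"
proof -
  obtain c where c: "c \<in> padic_Ints"
    "\<psi> (c * (of_nat (weight CARD('p) i) * a $ i)) \<noteq> 1 \<or> \<psi> (c * (of_nat (weight CARD('p) i) * b $ i)) \<noteq> 1"
    using assms character_detects_Ints by metis
  show ?thesis
  proof (rule C_coeff_eq_0_coordinate)
    show "padic_p ^ r * c \<in> padic_Ints" "of_nat (weight CARD('p) i) * c \<in> padic_Ints"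
      using c(1) by auto
    show "\<psi> (of_nat (weight CARD('p) i) * a $ i * c) \<noteq> 1 \<or> \<psi> (of_nat (weight CARD('p) i) * b $ i * c) \<noteq> 1"
      using c(2) by (simp only: mult.commute)
  qed
qed

text \<open>In the second block the weight \<open>p\<close> leaves room for a translation by
  \<open>c / p\<close> with \<open>c\<close> integral; as \<open>r > 0\<close>, it stays inside the
  domain of integration.\<close>

lemma C_coeff_eq_0_if_not_integral:
  assumes "a $ Inr i \<notin> padic_Ints \<or> b $ Inr i \<notin> padic_Ints" "r > 0"
  shows "C_coeff \<mu> \<psi> r (a, b) = 0"
proof -
  obtain c where c: "c \<in> padic_Ints" "\<psi> (c * a $ Inr i) \<noteq> 1 \<or> \<psi> (c * b $ Inr i) \<noteq> 1"
    using assms character_detects_Ints by metis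
  obtain n where r: "r = Suc n" using assms(2) by (cases r) auto
  show ?thesis
  proof (rule C_coeff_eq_0_coordinate)
    have "padic_p ^ r * (c / padic_p) = padic_p ^ n * c"
      by (simp add: r)
    then show "padic_p ^ r * (c / padic_p) \<in> padic_Ints"
      using padic_Ints_mult[OF padic_Ints_power[OF padic_Ints_of_int(2)] c(1)] by (simp only:)
    show "of_nat (weight CARD('p) (Inr i)) * (c / padic_p) \<in> padic_Ints"
      using c(1) by simp
    have "of_nat (weight CARD('p) (Inr i)) * z * (c / padic_p) = c * z" for z :: "'p padic"
      by simp
    then show "\<psi> (of_nat (weight CARD('p) (Inr i)) * a $ Inr i * (c / padic_p)) \<noteq> 1 \<or>
        \<psi> (of_nat (weight CARD('p) (Inr i)) * b $ Inr i * (c / padic_p)) \<noteq> 1"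
      using c(2) by (simp only:)
  qed
qed

section \<open>Evaluation of the coefficients on the dual lattice and on the lattice\<close>

context
  assumes mu_L: "emeasure \<mu> lattice_L = 1"
begin

text \<open>A vector of the dual lattice pairs integrally with \<open>lattice_L\<close>, so the
  character is constant on cosets, and so is the indicator.\<close>

lemma C_coeff_eq_sum:
  fixes a b :: "('p padic, 'm + 'm) vec"
  assumes dual: "\<And>i. of_nat (weight CARD('p) i) * a $ i \<in> padic_Ints" "\<And>i. of_nat (weight CARD('p) i) * b $ i \<in> padic_Ints"
  shows "C_coeff \<mu> \<psi> r (a, b) = (\<Sum>F\<in>point_indices (int CARD('p) ^ r).
    \<psi> (bilin_form (a, b) (lattice_point r F)) * of_bool (padic_p ^ r * quad_form (lattice_point r F :: ('p, 'm) quad_space) \<in> padic_Ints))"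
  unfolding C_coeff_def
proof (rule set_integral_lattice_invariant[OF mu mu_L])
  fix x l :: "('p, 'm) quad_space"
  assume x: "x \<in> quad_scale (padic_p powi (- int r)) ` lattice_L" and l: "l \<in> lattice_L"
  obtain c d where cd: "l = (c, d)" by (cases l)
  have "bilin_form (a, b) l = (\<Sum>i\<in>UNIV. (of_nat (weight CARD('p) i) * a $ i) * d $ i + (of_nat (weight CARD('p) i) * b $ i) * c $ i)"
    by (simp add: cd bilin_form_weight algebra_simps)
  also have "\<dots> \<in> padic_Ints"
    using l unfolding cd
    by (intro padic_Ints_sum padic_Ints_add padic_Ints_mult dual) (auto simp: lattice_L_def)
  finally have "\<psi> (bilin_form (a, b) l) = 1"
    by (rule character_Ints[OF psi])
  then show "\<psi> (bilin_form (a, b) (x + l)) * of_bool (padic_p ^ r * quad_form (x + l) \<in> padic_Ints) =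
      \<psi> (bilin_form (a, b) x) * of_bool (padic_p ^ r * quad_form x \<in> padic_Ints)"
    using quad_form_translate_Ints_iff[OF bilin_form_scaled_Ints[OF x l], of] quad_form_Ints[OF l]
    by (simp add: bilin_form_add_right character_add[OF psi] padic_Ints_mult padic_Ints_power)
qed

lemma C_coeff_0:
  fixes a b :: "('p padic, 'm + 'm) vec"
  assumes dual: "\<And>i. of_nat (weight CARD('p) i) * a $ i \<in> padic_Ints" "\<And>i. of_nat (weight CARD('p) i) * b $ i \<in> padic_Ints"
  shows "C_coeff \<mu> \<psi> 0 (a, b) = 1"
proof -
  have "{0..<1::int} = {0}" by auto
  then have "point_indices (int CARD('p) ^ 0) = {(\<lambda>_. (0, 0)) :: 'm + 'm \<Rightarrow> int \<times> int}"
    by (simp add: point_indices_def restrict_UNIV)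
  then show ?thesis
    by (simp add: C_coeff_eq_sum[OF dual] lattice_point_def bilin_form_weight quad_form_weight character_Ints[OF psi])
qed

text \<open>With the coordinates replaced by integers approximating them, this is
  \<open>isotropic_sum\<close>; its divisibility conditions on weighted coordinates, coordinates and
  \<open>Q\<close> become bounds by \<open>k2\<close>, \<open>k1\<close> and
  \<open>k\<close>.\<close>

lemma C_coeff_formula:
  fixes a b :: "('p padic, 'm + 'm) vec"
  defines "p \<equiv> CARD('p)" and "m \<equiv> CARD('m)"
  assumes int: "\<And>i. a $ i \<in> padic_Ints" "\<And>i. b $ i \<in> padic_Ints"
    and k1: "Fin k1 = min (vector_val (part1 (a, b))) (vector_val (part2 (a, b)))"
    and k2: "Fin k2 = min (vector_val (part1 (a, b))) (vector_val (part2 (a, b)) + 1)"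
    and k: "Fin k = padic_val (quad_form (a, b))"
  shows "of_nat p ^ r * C_coeff \<mu> \<psi> r (a, b) =
    of_bool (int r \<le> k2) * of_nat p ^ (4 * m * r) +
    (\<Sum>j<r. of_bool (int j \<le> k1) * of_nat p ^ ((r + j) * (2 * m) + m) *
      (of_nat p ^ (r - j) * of_bool (int (r + j) \<le> k) -
       of_nat p ^ (r - j - 1) * of_bool (int (r + j - 1) \<le> k)))"
proof -
  let ?P = "padic_p :: 'p padic"
  let ?w = "\<lambda>i :: 'm + 'm. weight p i"
  define \<theta> where "\<theta> = (\<lambda>n. \<psi> (of_int n / ?P ^ r))"
  interpret primitive_character p r \<theta>
    unfolding \<theta>_def p_def by (rule character_primitive[OF psi])
  \<comment> \<open>precision \<open>2 * r\<close>, because divisibility of \<open>q(\<eta>)\<close> by \<open>p\<^bsup>r + j\<^esup>\<close> with \<open>j < r\<close> has to be decided\<close>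
  have "\<forall>i. \<exists>n. (a $ i - of_int n) / ?P ^ (2 * r) \<in> padic_Ints" "\<forall>i. \<exists>n. (b $ i - of_int n) / ?P ^ (2 * r) \<in> padic_Ints"
    using padic_Ints_approx[OF int(1)] padic_Ints_approx[OF int(2)] by blast+
  then obtain A B where AB: "\<And>i. (a $ i - of_int (A i)) / ?P ^ (2 * r) \<in> padic_Ints"
    "\<And>i. (b $ i - of_int (B i)) / ?P ^ (2 * r) \<in> padic_Ints"
    by metis
  define Q where "Q = (\<Sum>i\<in>UNIV. int (?w i) * (A i * B i))"
  have lower: "z / ?P ^ s \<in> padic_Ints" if "z / ?P ^ (2 * r) \<in> padic_Ints" "s \<le> 2 * r" for z s
  proof -
    have "z / ?P ^ s = ?P ^ (2 * r - s) * (z / ?P ^ (2 * r))"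
      using that(2) by (simp add: power_diff)
    also have "\<dots> \<in> padic_Ints"
      by (intro padic_Ints_mult padic_Ints_power padic_Ints_of_int that(1))
    finally show ?thesis .
  qed
  have transfer: "int p ^ s dvd n \<longleftrightarrow> z / ?P ^ s \<in> padic_Ints"
    if "(z - of_int n) / ?P ^ (2 * r) \<in> padic_Ints" "s \<le> 2 * r" for z n s
    using padic_Ints_add_cancel[OF lower[OF that, unfolded diff_divide_distrib]] of_int_div_power_Ints_iff[of n s, where 'p = 'p]
    by (simp add: p_def)
  have AB': "(of_nat (?w i) * a $ i - of_int (int (?w i) * A i)) / ?P ^ (2 * r) \<in> padic_Ints"
    "(of_nat (?w i) * b $ i - of_int (int (?w i) * B i)) / ?P ^ (2 * r) \<in> padic_Ints" for i
    using padic_Ints_mult[OF padic_Ints_of_int(2)[of "?w i"] AB(1)[of i]]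
      padic_Ints_mult[OF padic_Ints_of_int(2)[of "?w i"] AB(2)[of i]]
    by (simp_all add: right_diff_distrib)
  have powi: "?P powi (- int s) * z = z / ?P ^ s" for s z
    by (simp add: power_int_minus divide_inverse mult.commute)
  have dvd1: "(\<forall>i. int p ^ s dvd A i \<and> int p ^ s dvd B i) \<longleftrightarrow> int s \<le> k1" if "s \<le> 2 * r" for s
    using le_min_val_iff[of "int s" a b] unfolding k1[symmetric] powi
    by (simp add: transfer[OF AB(1) that] transfer[OF AB(2) that])
  have dvd2: "(\<forall>i. int p ^ s dvd int (?w i) * A i \<and> int p ^ s dvd int (?w i) * B i) \<longleftrightarrow> int s \<le> k2" if "s \<le> 2 * r" for s
    using le_min_val_weight_iff[of "int s" a b] unfolding k2[symmetric] powi
    by (simp only: transfer[OF AB'(1) that] transfer[OF AB'(2) that]) (simp add: p_def)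
  have Qdiff: "(quad_form (a, b) - of_int Q) / ?P ^ (2 * r) \<in> padic_Ints"
  proof -
    \<comment> \<open>Coordinatewise,
      \<open>a * b - A * B = a * (b - B) + B * (a - A)\<close>.\<close>
    have "(quad_form (a, b) - of_int Q) / ?P ^ (2 * r) =
        (\<Sum>i\<in>UNIV. of_nat (?w i) * (a $ i * ((b $ i - of_int (B i)) / ?P ^ (2 * r)) +
          of_int (B i) * ((a $ i - of_int (A i)) / ?P ^ (2 * r))))"
      by (simp add: quad_form_weight Q_def p_def sum_divide_distrib diff_divide_distrib algebra_simps
          flip: sum_subtractf)
    also have "\<dots> \<in> padic_Ints"
      by (intro padic_Ints_sum padic_Ints_mult padic_Ints_add padic_Ints_of_int int AB)
    finally show ?thesis .
  qed
  have dvdQ: "int p ^ s dvd Q \<longleftrightarrow> int s \<le> k" if "s \<le> 2 * r" for s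
    using transfer[OF Qdiff that] padic_val_ge_iff[of "int s" "quad_form (a, b)"] unfolding k[symmetric] powi
    by simp
  define d where "d = (case_sum (\<lambda>_. 0) (\<lambda>_. 1) :: 'm + 'm \<Rightarrow> nat)"
  have d: "d i \<le> 1" "int p ^ d i = int (?w i)" for i
    by (cases i; simp add: d_def)+
  have sum_d: "(\<Sum>i\<in>UNIV. d i) = m" and card: "CARD('m + 'm) = 2 * m"
    by (simp_all add: sum_UNIV_sum_type d_def m_def)
  have weighted: "of_nat (?w i) * a $ i \<in> padic_Ints" "of_nat (?w i) * b $ i \<in> padic_Ints" for i
    using int by auto
  have "C_coeff \<mu> \<psi> r (a, b) = (\<Sum>F\<in>point_indices (int p ^ r).
      \<theta> (\<Sum>i\<in>UNIV. int (?w i) * (A i * snd (F i) + B i * fst (F i))) *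
      of_bool (int p ^ r dvd (\<Sum>i\<in>UNIV. int (?w i) * (fst (F i) * snd (F i)))))"
    unfolding C_coeff_eq_sum[OF weighted[unfolded p_def]]
  proof (intro sum.cong arg_cong2[where f = "(*)"] arg_cong[where f = of_bool])
    show "point_indices (int CARD('p) ^ r) = point_indices (int p ^ r)"
      by (simp only: p_def)
  next
    fix F :: "'m + 'm \<Rightarrow> int \<times> int"
    let ?S = "\<Sum>i\<in>UNIV. int (?w i) * (fst (F i) * snd (F i))"
    \<comment> \<open>Two coordinates with denominator \<open>p ^ r\<close> against one factor
      \<open>p ^ r\<close>: one denominator survives and becomes a divisibility condition.\<close>
    have "?P ^ r * quad_form (lattice_point r F :: ('p, 'm) quad_space) = of_int ?S / ?P ^ r"
      by (simp add: lattice_point_def quad_form_weight p_def sum_distrib_left sum_divide_distrib)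
    then show "?P ^ r * quad_form (lattice_point r F :: ('p, 'm) quad_space) \<in> padic_Ints \<longleftrightarrow> int p ^ r dvd ?S"
      using of_int_div_power_Ints_iff[of ?S r, where 'p = 'p] by (simp only: p_def)
    show "\<psi> (bilin_form (a, b) (lattice_point r F)) =
        \<theta> (\<Sum>i\<in>UNIV. int (?w i) * (A i * snd (F i) + B i * fst (F i)))"
      unfolding \<theta>_def
    proof (rule character_cong[OF psi])
      have "bilin_form (a, b) (lattice_point r F) -
          of_int (\<Sum>i\<in>UNIV. int (?w i) * (A i * snd (F i) + B i * fst (F i))) / ?P ^ r =
        (\<Sum>i\<in>UNIV. of_nat (?w i) * ((a $ i - of_int (A i)) / ?P ^ r * of_int (snd (F i)) +
          (b $ i - of_int (B i)) / ?P ^ r * of_int (fst (F i))))"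
        by (simp add: lattice_point_def bilin_form_weight p_def sum_divide_distrib add_divide_distrib
            diff_divide_distrib algebra_simps flip: sum_subtractf)
      also have "\<dots> \<in> padic_Ints"
        using lower[OF AB(1)] lower[OF AB(2)]
        by (intro padic_Ints_sum padic_Ints_mult padic_Ints_add padic_Ints_of_int) auto
      finally show "bilin_form (a, b) (lattice_point r F) -
          of_int (\<Sum>i\<in>UNIV. int (?w i) * (A i * snd (F i) + B i * fst (F i))) / ?P ^ r \<in> padic_Ints" .
    qed
  qed
  then have "of_nat p ^ r * C_coeff \<mu> \<psi> r (a, b) =
    of_bool (\<forall>i. int p ^ r dvd int (?w i) * A i \<and> int p ^ r dvd int (?w i) * B i) * of_nat p ^ (2 * r * CARD('m + 'm)) +
    (\<Sum>j<r. of_bool (\<forall>i. int p ^ j dvd A i \<and> int p ^ j dvd B i) *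
      of_nat p ^ ((r + j) * CARD('m + 'm) + (\<Sum>i\<in>UNIV. d i)) *
      (of_nat p ^ (r - j) * of_bool (int p ^ (r + j) dvd Q) -
       of_nat p ^ (r - j - 1) * of_bool (int p ^ (r + j - 1) dvd Q)))"
    using isotropic_sum[of d A B] d(1) unfolding d(2) Q_def by (simp only:)
  also have "\<dots> = of_bool (int r \<le> k2) * of_nat p ^ (4 * m * r) +
    (\<Sum>j<r. of_bool (int j \<le> k1) * of_nat p ^ ((r + j) * (2 * m) + m) *
      (of_nat p ^ (r - j) * of_bool (int (r + j) \<le> k) -
       of_nat p ^ (r - j - 1) * of_bool (int (r + j - 1) \<le> k)))"
  proof (intro arg_cong2[where f = "(+)"] sum.cong refl)
    show "of_bool (\<forall>i. int p ^ r dvd int (?w i) * A i \<and> int p ^ r dvd int (?w i) * B i) * (of_nat p :: complex) ^ (2 * r * CARD('m + 'm)) =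
        of_bool (int r \<le> k2) * of_nat p ^ (4 * m * r)"
      using dvd2[of r] unfolding card by (simp add: mult_ac)
  next
    fix j assume "j \<in> {..<r}"
    then have j: "j < r" by simp
    then have "(\<forall>i. int p ^ j dvd A i \<and> int p ^ j dvd B i) \<longleftrightarrow> int j \<le> k1"
      "int p ^ (r + j) dvd Q \<longleftrightarrow> int (r + j) \<le> k" "int p ^ (r + j - 1) dvd Q \<longleftrightarrow> int (r + j - 1) \<le> k"
      by (intro dvd1 dvdQ; simp)+
    then show "of_bool (\<forall>i. int p ^ j dvd A i \<and> int p ^ j dvd B i) *
      of_nat p ^ ((r + j) * CARD('m + 'm) + (\<Sum>i\<in>UNIV. d i)) *
      (of_nat p ^ (r - j) * of_bool (int p ^ (r + j) dvd Q) -
       of_nat p ^ (r - j - 1) * of_bool (int p ^ (r + j - 1) dvd Q)) =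
      of_bool (int j \<le> k1) * of_nat p ^ ((r + j) * (2 * m) + m) *
      (of_nat p ^ (r - j) * of_bool (int (r + j) \<le> k) -
       (of_nat p :: complex) ^ (r - j - 1) * of_bool (int (r + j - 1) \<le> k))"
      by (simp only: card sum_d)
  qed
  finally show ?thesis .
qed

end

end

section \<open>The generating function\<close>

text \<open>Substituting \<open>r = j + e\<close> turns \<open>j < r\<close> into
  \<open>e \<ge> 1\<close>, and the vanishing for \<open>r + j > n\<close> into the cutoff
  \<open>e \<le> n - 2 * j\<close>.\<close>

lemma sum_truncate_shift:
  fixes f :: "nat \<Rightarrow> 'a::comm_monoid_add"
  assumes "\<And>r. r + j > n \<Longrightarrow> f r = 0" "2 * j \<le> n"
  shows "(\<Sum>r\<le>n. if j < r then f r else 0) = (\<Sum>e=1..n - 2 * j. f (j + e))"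
proof -
  have "(\<Sum>r\<le>n. if j < r then f r else 0) = (\<Sum>r=1 + j..(n - 2 * j) + j. f r)"
    using assms by (intro sum.mono_neutral_cong_right) auto
  also have "\<dots> = (\<Sum>e=1..n - 2 * j. f (e + j))"
    by (rule sum.shift_bounds_cl_nat_ivl)
  finally show ?thesis by (simp only: add.commute)
qed

text \<open>In the application \<open>P\<close> is \<open>p\<close> and \<open>Y\<close> is
  \<open>p\<close> to the power \<open>- s\<close>. The coefficients vanish for
  \<open>r > K + 1\<close>, so the series is a finite sum, and \<open>r = j + e\<close> separates
  the powers of \<open>T\<close> from those of \<open>Z\<close>.\<close>

lemma sum_generating_function:
  fixes P Y :: complex and c :: "nat \<Rightarrow> complex"
  assumes P: "P \<noteq> 0" and K: "2 * K1 \<le> K" "K2 \<le> K"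
    and c: "\<And>r. P ^ r * c r = of_bool (r \<le> K2) * P ^ (4 * m * r) +
      (\<Sum>j<r. of_bool (j \<le> K1) * P ^ ((r + j) * (2 * m) + m) *
        (P ^ (r - j) * of_bool (r + j \<le> K) - P ^ (r - j - 1) * of_bool (r + j - 1 \<le> K)))"
  defines "Z \<equiv> P ^ (2 * m) * Y" and "T \<equiv> P ^ (4 * m) * (Y / P)"
  shows "(\<lambda>r. Y ^ r * c r) sums
    ((1 - Z / P) * (P ^ m * (\<Sum>j\<le>K1. T ^ j * (\<Sum>e=1..K - 2 * j. Z ^ e))) +
      (\<Sum>r\<le>K2. T ^ r) - P ^ m * (Z / P) * (\<Sum>j\<le>K1. T ^ j))"
proof -
  \<comment> \<open>Dividing by \<open>P\<close> absorbs the factor \<open>P ^ r\<close> that stands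
    on the left of the recursion-free formula for \<open>c\<close>.\<close>
  define U where "U = Y / P"
  define X where "X r j = P ^ ((r + j) * (2 * m) + m) *
        (P ^ (r - j) * of_bool (r + j \<le> K) - P ^ (r - j - 1) * of_bool (r + j - 1 \<le> K))" for r j
  have summand: "Y ^ r * c r = of_bool (r \<le> K2) * T ^ r + (\<Sum>j<r. of_bool (j \<le> K1) * (U ^ r * X r j))" for r
  proof -
    have "Y ^ r * c r = U ^ r * (P ^ r * c r)"
      using P by (simp add: U_def power_divide)
    also have "\<dots> = of_bool (r \<le> K2) * T ^ r + (\<Sum>j<r. of_bool (j \<le> K1) * (U ^ r * X r j))"
      unfolding c X_def[symmetric] mult.assoc[of "of_bool _"] distrib_left sum_distrib_left
    proof (intro arg_cong2[where f = "(+)"] sum.cong refl)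
      show "U ^ r * (of_bool (r \<le> K2) * P ^ (4 * m * r)) = of_bool (r \<le> K2) * T ^ r"
        unfolding T_def U_def[symmetric] power_mult[of P "4 * m" r] by (simp only: power_mult_distrib mult_ac)
    qed (simp only: X_def mult_ac)
    finally show ?thesis .
  qed
  have X0: "X r j = 0" if "r + j > K + 1" for r j
  proof -
    have "\<not> r + j \<le> K" "\<not> r + j - 1 \<le> K" using that by linarith+
    then show ?thesis by (simp add: X_def)
  qed
  have swap: "(\<Sum>j<r. of_bool (j \<le> K1) * (U ^ r * X r j)) = (\<Sum>j\<le>K1. if j < r then U ^ r * X r j else 0)" for r
  proof -
    have "(\<Sum>j<r. of_bool (j \<le> K1) * (U ^ r * X r j)) = (\<Sum>j\<in>{..<r} \<inter> {..K1}. U ^ r * X r j)"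
      by (intro sum.mono_neutral_cong_right) auto
    also have "\<dots> = (\<Sum>j\<le>K1. if j < r then U ^ r * X r j else 0)"
      by (intro sum.mono_neutral_cong_left) auto
    finally show ?thesis .
  qed
  have zero: "Y ^ r * c r = 0" if "r \<notin> {..K + 1}" for r
    using that K(2) by (simp add: summand X0)
  have UX: "U ^ (j + e) * X (j + e) j =
      P ^ m * T ^ j * (Z ^ e * of_bool (e + 2 * j \<le> K) - Z ^ e / P * of_bool (e + 2 * j \<le> K + 1))" if e: "e \<ge> 1" for j e
  proof -
    have Pe: "P ^ (e - 1) = P ^ e / P"
      using e P by (simp add: power_diff)
    have le: "j + e + j \<le> K \<longleftrightarrow> e + 2 * j \<le> K" "j + e + j - 1 \<le> K \<longleftrightarrow> e + 2 * j \<le> K + 1"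
      using e by auto
    \<comment> \<open>This splitting of the exponent is the source of \<open>T ^ j\<close> and
      \<open>Z ^ e\<close>: each \<open>j\<close> carries \<open>P ^ (4 * m) * U\<close>, each
      \<open>e\<close> carries \<open>P ^ (2 * m) * P * U\<close>.\<close>
    have "(j + e + j) * (2 * m) + m = m + 4 * m * j + 2 * m * e"
      by (simp add: algebra_simps)
    then have "P ^ ((j + e + j) * (2 * m) + m) = P ^ m * (P ^ (4 * m)) ^ j * (P ^ (2 * m)) ^ e"
      by (simp only: power_add power_mult)
    then have "U ^ (j + e) * P ^ ((j + e + j) * (2 * m) + m) * P ^ e =
        P ^ m * (P ^ (4 * m) * U) ^ j * (P ^ (2 * m) * (P * U)) ^ e"
      by (simp only: power_add[of U] power_mult_distrib mult_ac)
    also have "\<dots> = P ^ m * T ^ j * Z ^ e"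
      using P by (simp add: T_def Z_def U_def)
    finally have *: "U ^ (j + e) * P ^ ((j + e + j) * (2 * m) + m) * P ^ e = P ^ m * T ^ j * Z ^ e" .
    have "U ^ (j + e) * X (j + e) j = (U ^ (j + e) * P ^ ((j + e + j) * (2 * m) + m) * P ^ e) *
        (of_bool (e + 2 * j \<le> K) - of_bool (e + 2 * j \<le> K + 1) / P)"
      unfolding X_def le diff_add_inverse Pe by (simp add: algebra_simps)
    then show ?thesis
      unfolding * by (simp add: algebra_simps)
  qed
  have inner: "(\<Sum>r\<le>K + 1. if j < r then U ^ r * X r j else 0) =
      P ^ m * T ^ j * ((1 - Z / P) * (\<Sum>e=1..K - 2 * j. Z ^ e) - Z / P)" if j: "j \<le> K1" for j
  proof -
    have jK: "2 * j \<le> K" using j K by simp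
    have "(\<Sum>r\<le>K + 1. if j < r then U ^ r * X r j else 0) = (\<Sum>e=1..K + 1 - 2 * j. U ^ (j + e) * X (j + e) j)"
      using jK by (intro sum_truncate_shift) (simp_all add: X0)
    also have "\<dots> = (\<Sum>e=1..K + 1 - 2 * j. P ^ m * T ^ j *
        (Z ^ e * of_bool (e + 2 * j \<le> K) - Z ^ e / P * of_bool (e + 2 * j \<le> K + 1)))"
      by (intro sum.cong refl UX) simp
    also have "\<dots> = P ^ m * T ^ j * ((\<Sum>e=1..K + 1 - 2 * j. Z ^ e * of_bool (e + 2 * j \<le> K)) -
        (\<Sum>e=1..K + 1 - 2 * j. Z ^ e / P * of_bool (e + 2 * j \<le> K + 1)))"
      by (simp only: sum_distrib_left[symmetric] sum_subtractf)
    also have "(\<Sum>e=1..K + 1 - 2 * j. Z ^ e * of_bool (e + 2 * j \<le> K)) = (\<Sum>e=1..K - 2 * j. Z ^ e)"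
      by (intro sum.mono_neutral_cong_right) auto
    \<comment> \<open>The subtracted sum is one term longer. Shifting its index shows
      \<open>Z / P\<close> times the first sum, which gives the factor \<open>1 - Z / P\<close>, and
      an extra \<open>Z / P\<close> from \<open>e = 1\<close>.\<close>
    also have "(\<Sum>e=1..K + 1 - 2 * j. Z ^ e / P * of_bool (e + 2 * j \<le> K + 1)) = (\<Sum>e=1..Suc (K - 2 * j). Z ^ e / P)"
      using jK by (intro sum.cong) auto
    also have "\<dots> = Z / P + (\<Sum>e=1..K - 2 * j. Z ^ Suc e / P)"
      by (subst sum.atLeast_Suc_atMost) (simp_all add: sum.shift_bounds_cl_Suc_ivl del: sum.cl_ivl_Suc power_Suc)
    also have "\<dots> = Z / P + Z / P * (\<Sum>e=1..K - 2 * j. Z ^ e)"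
      by (simp add: sum_distrib_left)
    finally show ?thesis by (simp add: algebra_simps)
  qed
  have split: "(\<Sum>j\<le>K1. P ^ m * T ^ j * (a * S j - b)) = a * (P ^ m * (\<Sum>j\<le>K1. T ^ j * S j)) - P ^ m * b * (\<Sum>j\<le>K1. T ^ j)"
    for a b :: complex and S
    unfolding sum_distrib_left sum_subtractf[symmetric] by (intro sum.cong refl) (simp only: right_diff_distrib mult_ac)
  have "(\<Sum>r\<le>K + 1. Y ^ r * c r) = (\<Sum>r\<le>K + 1. of_bool (r \<le> K2) * T ^ r) +
      (\<Sum>j\<le>K1. \<Sum>r\<le>K + 1. if j < r then U ^ r * X r j else 0)"
    unfolding summand swap sum.distrib by (subst sum.swap) simp
  also have "(\<Sum>r\<le>K + 1. of_bool (r \<le> K2) * T ^ r) = (\<Sum>r\<le>K2. T ^ r)"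
    using K by (intro sum.mono_neutral_cong_right) auto
  also have "(\<Sum>j\<le>K1. \<Sum>r\<le>K + 1. if j < r then U ^ r * X r j else 0) =
      (\<Sum>j\<le>K1. P ^ m * T ^ j * ((1 - Z / P) * (\<Sum>e=1..K - 2 * j. Z ^ e) - Z / P))"
    by (intro sum.cong refl inner) simp
  also have "\<dots> = (1 - Z / P) * (P ^ m * (\<Sum>j\<le>K1. T ^ j * (\<Sum>e=1..K - 2 * j. Z ^ e))) -
      P ^ m * (Z / P) * (\<Sum>j\<le>K1. T ^ j)"
    by (rule split)
  finally have total: "(\<Sum>r\<le>K + 1. Y ^ r * c r) =
      (1 - Z / P) * (P ^ m * (\<Sum>j\<le>K1. T ^ j * (\<Sum>e=1..K - 2 * j. Z ^ e))) +
      (\<Sum>r\<le>K2. T ^ r) - P ^ m * (Z / P) * (\<Sum>j\<le>K1. T ^ j)"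
    by simp
  show ?thesis
    unfolding total[symmetric] by (rule sums_finite) (use zero in auto)
qed

section \<open>The polynomial \<open>R\<close>\<close>

lemma sum_int_interval: "(\<Sum>r = int a..int b. f r) = (\<Sum>r = a..b. f (int r))"
  by (subst image_int_atLeastAtMost[symmetric]) (simp add: sum.reindex)

context
  fixes p m K1 K2 K :: nat
  assumes p: "p > 1" and m: "m > 0" and K: "K1 \<le> K2" "K2 \<le> K1 + 1" "K1 + K2 \<le> K"
begin

text \<open>Apart from the factor \<open>p ^ m\<close>, this is the coefficient of
  \<open>R_poly\<close> in degrees 1 to \<open>K\<close>. A sum instead of a quotient shows
  integrality, and the length is symmetric under exchanging \<open>r\<close> and
  \<open>K + 1 - r\<close>.\<close>

definition palindromic_coeff :: "nat \<Rightarrow> complex" where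
  "palindromic_coeff r = (\<Sum>j<min (K1 + 1) (min r (K + 1 - r)). (of_nat p ^ (2 * m - 1)) ^ j)"

lemma Q_neq_1: "(of_nat p :: complex) ^ (2 * m - 1) \<noteq> 1"
proof -
  have "p ^ (2 * m - 1) \<noteq> 1" using p m by (simp add: power_eq_1_iff)
  then show ?thesis by (metis of_nat_1 of_nat_eq_iff of_nat_power)
qed

text \<open>The three ranges of \<open>R_poly\<close> are those where the minimum is
  \<open>r\<close>, \<open>K1 + 1\<close> and \<open>K + 1 - r\<close>, respectively; on the first
  one this rests on \<open>K2 \<le> K1 + 1\<close>.\<close>

lemma R_poly_eq:
  "R_poly p m (int K1) (int K2) (int K) (int K - int K1 - int K2) =
    smult (of_nat p ^ m) (\<Sum>r = 1..K. monom (palindromic_coeff r) r)"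
proof -
  define g where "g j = (of_nat p ^ (nat j * (2 * m - 1)) - 1) / (of_nat p ^ (2 * m - 1) - 1 :: complex)" for j :: int
  have g: "g (int n) = (\<Sum>j<n. (of_nat p ^ (2 * m - 1)) ^ j)" for n
    unfolding g_def geometric_sum[OF Q_neq_1] by (simp add: mult.commute flip: power_mult)
  define n where "n = K - K1 - K2"
  have n: "K = K2 + n + K1" and int_n: "int K - int K1 - int K2 = int n"
    using K by (simp_all add: n_def)
  have split: "sum f {1..K} = sum f {1..K2} + (sum f {K2 + 1..K2 + n} + sum f {K2 + n + 1..K})" for f :: "nat \<Rightarrow> complex poly"
    using sum.ub_add_nat[of 1 K2 f "n + K1"] sum.ub_add_nat[of "K2 + 1" "K2 + n" f K1] by (simp add: n add.assoc)
  have "(\<Sum>r = 1..K. monom (palindromic_coeff r) r) =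
      (\<Sum>r = 1..K2. monom (palindromic_coeff r) r) + ((\<Sum>r = K2 + 1..K2 + n. monom (palindromic_coeff r) r) +
       (\<Sum>r = K2 + n + 1..K. monom (palindromic_coeff r) r))"
    by (rule split)
  also have "(\<Sum>r = 1..K2. monom (palindromic_coeff r) r) = (\<Sum>r = 1..K2. monom (g (int r)) r)"
  proof (intro sum.cong refl)
    fix r assume "r \<in> {1..K2}"
    then have "min (K1 + 1) (min r (K + 1 - r)) = r" using K by auto
    then show "monom (palindromic_coeff r) r = monom (g (int r)) r"
      by (simp only: g palindromic_coeff_def)
  qed
  also have "\<dots> = (\<Sum>r = 1..int K2. monom (g r) (nat r))"
    using sum_int_interval[of "\<lambda>r. monom (g r) (nat r)" 1 K2] by simp
  also have "(\<Sum>r = K2 + 1..K2 + n. monom (palindromic_coeff r) r) =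
      smult (g (int K1 + 1)) (\<Sum>r = int K2 + 1..int K2 + int n. monom 1 (nat r))"
  proof -
    have "int K1 + 1 = int (K1 + 1)" "int K2 + 1 = int (K2 + 1)" "int K2 + int n = int (K2 + n)" by simp_all
    then have "smult (g (int K1 + 1)) (\<Sum>r = int K2 + 1..int K2 + int n. monom 1 (nat r)) =
        (\<Sum>r = K2 + 1..K2 + n. monom (g (int (K1 + 1))) r)"
      by (simp only: sum_int_interval smult_sum2 smult_monom mult_1_right nat_int)
    also have "\<dots> = (\<Sum>r = K2 + 1..K2 + n. monom (palindromic_coeff r) r)"
    proof (intro sum.cong refl)
      fix r assume "r \<in> {K2 + 1..K2 + n}"
      then have "min (K1 + 1) (min r (K + 1 - r)) = K1 + 1" using K n by auto
      then show "monom (g (int (K1 + 1))) r = monom (palindromic_coeff r) r"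
        by (simp only: g palindromic_coeff_def)
    qed
    finally show ?thesis by (rule sym)
  qed
  also have "(\<Sum>r = K2 + n + 1..K. monom (palindromic_coeff r) r) =
      (\<Sum>r = int K2 + int n + 1..int K. monom (g (int K - r + 1)) (nat r))"
  proof -
    have "int K2 + int n + 1 = int (K2 + n + 1)" by simp
    then have "(\<Sum>r = int K2 + int n + 1..int K. monom (g (int K - r + 1)) (nat r)) =
        (\<Sum>r = K2 + n + 1..K. monom (g (int K - int r + 1)) r)"
      by (simp only: sum_int_interval nat_int)
    also have "\<dots> = (\<Sum>r = K2 + n + 1..K. monom (palindromic_coeff r) r)"
    proof (intro sum.cong refl)
      fix r assume r: "r \<in> {K2 + n + 1..K}"
      then have "int K - int r + 1 = int (K + 1 - r)" by auto
      moreover have "min (K1 + 1) (min r (K + 1 - r)) = K + 1 - r"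
        using r K n by auto
      ultimately show "monom (g (int K - int r + 1)) r = monom (palindromic_coeff r) r"
        by (simp only: g palindromic_coeff_def)
    qed
    finally show ?thesis by (rule sym)
  qed
  finally have total: "(\<Sum>r = 1..K. monom (palindromic_coeff r) r) =
      (\<Sum>r = 1..int K2. monom (g r) (nat r)) +
      (smult (g (int K1 + 1)) (\<Sum>r = int K2 + 1..int K2 + int n. monom 1 (nat r)) +
       (\<Sum>r = int K2 + int n + 1..int K. monom (g (int K - r + 1)) (nat r)))" .
  show ?thesis
    unfolding total int_n R_poly_def Let_def g_def by (simp only: add.assoc)
qed

lemma coeff_R_poly:
  "coeff (R_poly p m (int K1) (int K2) (int K) (int K - int K1 - int K2)) i =
    (if 1 \<le> i \<and> i \<le> K then of_nat p ^ m * palindromic_coeff i else 0)"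
  unfolding R_poly_eq by (auto simp: coeff_sum)

lemma coeff_R_poly_Ints: "coeff (R_poly p m (int K1) (int K2) (int K) (int K - int K1 - int K2)) i \<in> \<int>"
  unfolding coeff_R_poly palindromic_coeff_def by (auto intro!: Ints_mult Ints_sum Ints_power)

lemma degree_R_poly: "degree (R_poly p m (int K1) (int K2) (int K) (int K - int K1 - int K2)) = K"
proof (cases "K = 0")
  case True
  \<comment> \<open>Here the polynomial is 0, whose degree is 0 by convention.\<close>
  show ?thesis unfolding R_poly_eq using True by simp
next
  case False
  show ?thesis
  proof (rule antisym)
    show "degree (R_poly p m (int K1) (int K2) (int K) (int K - int K1 - int K2)) \<le> K"
      by (rule degree_le) (simp add: coeff_R_poly)
    \<comment> \<open>The geometric sum in top degree has the single term 1, so the leading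
      coefficient is \<open>p ^ m\<close>.\<close>
    have "min (K1 + 1) (min K (K + 1 - K)) = 1" using False by auto
    then have "coeff (R_poly p m (int K1) (int K2) (int K) (int K - int K1 - int K2)) K \<noteq> 0"
      using False p unfolding coeff_R_poly palindromic_coeff_def by simp
    then show "K \<le> degree (R_poly p m (int K1) (int K2) (int K) (int K - int K1 - int K2))"
      by (rule le_degree)
  qed
qed

lemma poly_R_poly: "poly (R_poly p m (int K1) (int K2) (int K) (int K - int K1 - int K2)) X =
    of_nat p ^ m * (\<Sum>r = 1..K. palindromic_coeff r * X ^ r)"
  by (simp add: R_poly_eq poly_sum poly_monom)

lemma R_poly_palindromic:
  assumes "X \<noteq> 0"
  shows "X ^ (K + 1) * poly (R_poly p m (int K1) (int K2) (int K) (int K - int K1 - int K2)) (inverse X) =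
    poly (R_poly p m (int K1) (int K2) (int K) (int K - int K1 - int K2)) X"
proof -
  have "(\<Sum>r = 1..K. X ^ (K + 1) * (palindromic_coeff r * inverse X ^ r)) = (\<Sum>r = 1..K. palindromic_coeff r * X ^ r)"
  proof (rule sum.reindex_bij_witness[where i = "\<lambda>r. K + 1 - r" and j = "\<lambda>r. K + 1 - r"])
    fix r assume r: "r \<in> {1..K}"
    then have "min (K + 1 - r) (K + 1 - (K + 1 - r)) = min r (K + 1 - r)" by auto
    then have "palindromic_coeff (K + 1 - r) = palindromic_coeff r"
      by (simp only: palindromic_coeff_def)
    moreover have "X ^ (K + 1) * inverse X ^ r = X ^ (K + 1 - r)"
      using r assms by (simp add: power_diff power_inverse divide_inverse)
    ultimately show "palindromic_coeff (K + 1 - r) * X ^ (K + 1 - r) = X ^ (K + 1) * (palindromic_coeff r * inverse X ^ r)"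
      by (metis mult.left_commute)
  qed auto
  then have "X ^ (K + 1) * (\<Sum>r = 1..K. palindromic_coeff r * inverse X ^ r) = (\<Sum>r = 1..K. palindromic_coeff r * X ^ r)"
    by (simp only: sum_distrib_left)
  then show ?thesis
    unfolding poly_R_poly by (metis mult.left_commute)
qed

text \<open>An index \<open>j\<close> occurs in the \<open>r\<close>-th coefficient iff
  \<open>j \<le> K1\<close>, \<open>j < r\<close> and \<open>r + j \<le> K\<close>. Exchanging the
  sums and putting \<open>r = j + e\<close> gives the shape met in the generating function.\<close>

lemma poly_R_poly_double_sum: "poly (R_poly p m (int K1) (int K2) (int K) (int K - int K1 - int K2)) Z =
    of_nat p ^ m * (\<Sum>j\<le>K1. (of_nat p ^ (2 * m - 1) * Z) ^ j * (\<Sum>e = 1..K - 2 * j. Z ^ e))"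
proof -
  let ?Q = "of_nat p ^ (2 * m - 1) :: complex"
  have coeff: "palindromic_coeff r * Z ^ r = (\<Sum>j\<le>K1. if j < r then (if r + j \<le> K then ?Q ^ j * Z ^ r else 0) else 0)"
    if "r \<in> {1..K}" for r
  proof -
    have "palindromic_coeff r * Z ^ r = (\<Sum>j<min (K1 + 1) (min r (K + 1 - r)). ?Q ^ j * Z ^ r)"
      by (simp add: palindromic_coeff_def sum_distrib_right)
    also have "\<dots> = (\<Sum>j\<le>K1. if j < r then (if r + j \<le> K then ?Q ^ j * Z ^ r else 0) else 0)"
      using that by (intro sum.mono_neutral_cong_left) auto
    finally show ?thesis .
  qed
  have inner: "(\<Sum>r = 1..K. if j < r then (if r + j \<le> K then ?Q ^ j * Z ^ r else 0) else 0) =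
      (?Q * Z) ^ j * (\<Sum>e = 1..K - 2 * j. Z ^ e)" if "j \<le> K1" for j
  proof -
    have j: "2 * j \<le> K" using that K by simp
    have "(\<Sum>r = 1..K. if j < r then (if r + j \<le> K then ?Q ^ j * Z ^ r else 0) else 0) =
        (\<Sum>r\<le>K. if j < r then (if r + j \<le> K then ?Q ^ j * Z ^ r else 0) else 0)"
      by (intro sum.mono_neutral_left) auto
    also have "\<dots> = (\<Sum>e = 1..K - 2 * j. if j + e + j \<le> K then ?Q ^ j * Z ^ (j + e) else 0)"
      using j by (intro sum_truncate_shift) auto
    also have "\<dots> = (\<Sum>e = 1..K - 2 * j. (?Q * Z) ^ j * Z ^ e)"
      using j by (intro sum.cong) (auto simp: power_add power_mult_distrib)
    finally show ?thesis by (simp add: sum_distrib_left)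
  qed
  have "(\<Sum>r = 1..K. palindromic_coeff r * Z ^ r) = (\<Sum>j\<le>K1. (?Q * Z) ^ j * (\<Sum>e = 1..K - 2 * j. Z ^ e))"
  proof -
    have "(\<Sum>r = 1..K. palindromic_coeff r * Z ^ r) =
        (\<Sum>r = 1..K. \<Sum>j\<le>K1. if j < r then (if r + j \<le> K then ?Q ^ j * Z ^ r else 0) else 0)"
      by (intro sum.cong refl coeff)
    also have "\<dots> = (\<Sum>j\<le>K1. \<Sum>r = 1..K. if j < r then (if r + j \<le> K then ?Q ^ j * Z ^ r else 0) else 0)"
      by (rule sum.swap)
    also have "\<dots> = (\<Sum>j\<le>K1. (?Q * Z) ^ j * (\<Sum>e = 1..K - 2 * j. Z ^ e))"
      by (intro sum.cong refl inner) simp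
    finally show ?thesis .
  qed
  then show ?thesis by (simp add: poly_R_poly)
qed

end

section \<open>The generating series outside the dual lattice, on its boundary and on the
  lattice\<close>

theorem theorem4p3:
  fixes p m :: nat
    and \<psi> :: "'p::prime_card padic \<Rightarrow> complex"
    and \<mu> :: "('p, 'm::finite) quad_space measure"
    and \<eta> :: "('p, 'm) quad_space"
    and k1 k2 k k' :: int
  assumes p: "p = CARD('p)" and m: "m = CARD('m)"
    and psi: "unitary_character \<psi>" "conductor_padic_Ints \<psi>"
    and mu: "haar_measure \<mu>" "emeasure \<mu> lattice_L = 1"
    and eta: "quad_form \<eta> \<noteq> 0"
    and k1: "Fin k1 = min (vector_val (part1 \<eta>)) (vector_val (part2 \<eta>))"
    and k2: "Fin k2 = min (vector_val (part1 \<eta>)) (vector_val (part2 \<eta>) + 1)"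
    and k: "Fin k = padic_val (quad_form \<eta>)"
    and k': "k' = k - k1 - k2"
  shows
    "(\<forall>s. summable (C_term \<mu> \<psi> \<eta> s)) \<and>
     ((\<exists>s. (\<Sum>r. C_term \<mu> \<psi> \<eta> s r) \<noteq> 0) \<longrightarrow> 0 \<le> k2) \<and>
     (k2 = 0 \<and> k1 = -1 \<longrightarrow> (\<forall>s. (\<Sum>r. C_term \<mu> \<psi> \<eta> s r) = 1)) \<and>
     (0 \<le> k1 \<and> k1 \<le> k2 \<longleftrightarrow> \<eta> \<in> lattice_L) \<and>
     (0 \<le> k1 \<and> k1 \<le> k2 \<longrightarrow>
       (\<forall>s. (\<Sum>r. C_term \<mu> \<psi> \<eta> s r) =
          (1 - of_nat p powr (2 * of_nat m - s - 1))
              * poly (R_poly p m k1 k2 k k') (of_nat p powr (2 * of_nat m - s))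
          + (\<Sum>r = 0..k2. of_nat p powr (of_int r * (4 * of_nat m - s - 1)))
          - of_nat p powr (3 * of_nat m - s - 1)
              * (\<Sum>r = 0..k1. of_nat p powr (of_int r * (4 * of_nat m - s - 1)))) \<and>
       (\<forall>i. coeff (R_poly p m k1 k2 k k') i \<in> \<int>) \<and>
       int (degree (R_poly p m k1 k2 k k')) = k \<and>
       (\<forall>X. X \<noteq> 0 \<longrightarrow>
          X ^ (nat k + 1) * poly (R_poly p m k1 k2 k k') (inverse X)
            = poly (R_poly p m k1 k2 k k') X))"
proof -
  define P where "P = (of_nat p :: complex)"
  have p_gt_1: "p > 1" unfolding p by (rule prime_gt_1_nat[OF prime_card])
  have m_pos: "m > 0" by (simp add: m)
  have P: "P \<noteq> 0" using p_gt_1 by (simp add: P_def)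
  obtain a b where ab: "\<eta> = (a, b)" by (cases \<eta>)
  note k1 = k1[unfolded ab] and k2 = k2[unfolded ab] and k = k[unfolded ab]
  \<comment> \<open>Raising one entry of a minimum by 1 raises the minimum by 0 or 1.\<close>
  have k12: "k1 \<le> k2" "k2 \<le> k1 + 1"
    using k1 k2 by (cases "vector_val (part1 (a, b))"; cases "vector_val (part2 (a, b))";
        auto simp: one_extended_def min_def split: if_splits)+
  have k1_iff: "j \<le> k1 \<longleftrightarrow> (\<forall>i. padic_p powi (- j) * a $ i \<in> padic_Ints \<and> padic_p powi (- j) * b $ i \<in> padic_Ints)" for j
    using le_min_val_iff[of j a b] unfolding k1[symmetric] by simp
  have k2_iff: "j \<le> k2 \<longleftrightarrow> (\<forall>i. padic_p powi (- j) * (of_nat (weight CARD('p) i) * a $ i) \<in> padic_Ints \<and>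
      padic_p powi (- j) * (of_nat (weight CARD('p) i) * b $ i) \<in> padic_Ints)" for j
    using le_min_val_weight_iff[of j a b] unfolding k2[symmetric] by simp
  have k_ge: "k1 + k2 \<le> k"
  proof -
    have powi: "(padic_p :: 'p padic) powi (- (k1 + k2)) = padic_p powi (- k1) * padic_p powi (- k2)"
      using power_int_add[of "padic_p :: 'p padic" "- k1" "- k2"] by simp
    \<comment> \<open>Each term of the form pairs a weighted coordinate, divisible by
      \<open>p\<close> to the power \<open>k2\<close>, with an unweighted one, divisible by
      \<open>p\<close> to the power \<open>k1\<close>.\<close>
    have "padic_p powi (- (k1 + k2)) * quad_form (a, b) =
        (\<Sum>i\<in>UNIV. (padic_p powi (- k2) * (of_nat (weight CARD('p) i) * a $ i)) * (padic_p powi (- k1) * b $ i))"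
      unfolding powi by (simp add: quad_form_weight sum_distrib_left mult_ac)
    also have "\<dots> \<in> padic_Ints"
    proof (rule padic_Ints_sum)
      fix i
      have "padic_p powi (- k2) * (of_nat (weight CARD('p) i) * a $ i) \<in> padic_Ints"
        "padic_p powi (- k1) * b $ i \<in> padic_Ints"
        using k1_iff[of k1] k2_iff[of k2] by blast+
      then show "(padic_p powi (- k2) * (of_nat (weight CARD('p) i) * a $ i)) * (padic_p powi (- k1) * b $ i) \<in> padic_Ints"
        by (rule padic_Ints_mult)
    qed
    finally have "Fin (k1 + k2) \<le> padic_val (quad_form (a, b))"
      by (simp only: padic_val_ge_iff)
    then show ?thesis unfolding k[symmetric] by simp
  qed
  have integral: "0 \<le> k1 \<longleftrightarrow> (\<forall>i. a $ i \<in> padic_Ints \<and> b $ i \<in> padic_Ints)"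
    using k1_iff[of 0] by simp
  have dual: "0 \<le> k2 \<longleftrightarrow> (\<forall>i. of_nat (weight CARD('p) i) * a $ i \<in> padic_Ints \<and>
      of_nat (weight CARD('p) i) * b $ i \<in> padic_Ints)"
    using k2_iff[of 0] by simp
  have lattice: "0 \<le> k1 \<longleftrightarrow> \<eta> \<in> lattice_L"
    using integral by (auto simp: ab lattice_L_def)
  define Y where "Y s = P powr (- s)" for s
  have powr_nat_mult: "P powr (of_nat n * z) = (P powr z) ^ n" for n z
    using P by (simp add: powr_def exp_of_nat_mult[symmetric] mult_ac)
  have powr_shift: "P powr (of_nat n - s) = P ^ n * Y s" for n s
    using P by (simp add: Y_def powr_def left_diff_distrib exp_diff exp_minus exp_of_nat_mult divide_inverse)
  have powr_shift1: "P powr (of_nat n - s - 1) = P ^ n * Y s / P" for n s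
    using powr_shift[of n s] P by (simp add: powr_def left_diff_distrib exp_diff)
  have C_term: "C_term \<mu> \<psi> \<eta> s r = Y s ^ r * C_coeff \<mu> \<psi> r (a, b)" for s r
    using powr_nat_mult[of r "- s"] by (simp add: C_term_def ab Y_def P_def p)
  have not_dual: "C_term \<mu> \<psi> \<eta> s sums 0" if neg: "\<not> 0 \<le> k2" for s
  proof -
    obtain i where "of_nat (weight CARD('p) i) * a $ i \<notin> padic_Ints \<or> of_nat (weight CARD('p) i) * b $ i \<notin> padic_Ints"
      using neg dual by blast
    then have "C_coeff \<mu> \<psi> r (a, b) = 0" for r
      by (rule C_coeff_eq_0_if_not_dual[OF psi mu(1)])
    then have "C_term \<mu> \<psi> \<eta> s = (\<lambda>_. 0)" by (simp add: C_term fun_eq_iff)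
    then show ?thesis by simp
  qed
  have boundary: "C_term \<mu> \<psi> \<eta> s sums 1" if nonneg: "0 \<le> k2" and neg: "\<not> 0 \<le> k1" for s
  proof -
    have weighted: "of_nat (weight CARD('p) i) * a $ i \<in> padic_Ints" "of_nat (weight CARD('p) i) * b $ i \<in> padic_Ints" for i
      using nonneg dual by blast+
    obtain i where i: "a $ i \<notin> padic_Ints \<or> b $ i \<notin> padic_Ints"
      using neg integral by blast
    \<comment> \<open>In the first block the weight is 1, so integrality of the weighted coordinates
      puts the non-integral coordinate in the second block.\<close>
    then obtain i' where i': "i = Inr i'"
      using weighted[of i] by (cases i) auto
    have "C_coeff \<mu> \<psi> r (a, b) = 0" if "r > 0" for r
      using i that unfolding i' by (rule C_coeff_eq_0_if_not_integral[OF psi mu(1)])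
    moreover have "C_coeff \<mu> \<psi> 0 (a, b) = 1"
      by (rule C_coeff_0[OF psi mu weighted])
    ultimately have "C_term \<mu> \<psi> \<eta> s = (\<lambda>r. if r = 0 then 1 else 0)"
      by (auto simp: C_term fun_eq_iff)
    then show ?thesis using sums_single[of 0 "\<lambda>_. 1 :: complex"] by simp
  qed
  define total where "total s = (1 - of_nat p powr (2 * of_nat m - s - 1))
              * poly (R_poly p m k1 k2 k k') (of_nat p powr (2 * of_nat m - s))
          + (\<Sum>r = 0..k2. of_nat p powr (of_int r * (4 * of_nat m - s - 1)))
          - of_nat p powr (3 * of_nat m - s - 1)
              * (\<Sum>r = 0..k1. of_nat p powr (of_int r * (4 * of_nat m - s - 1)))" for s :: complex
  have main: "C_term \<mu> \<psi> \<eta> s sums total s \<and>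
       (\<forall>i. coeff (R_poly p m k1 k2 k k') i \<in> \<int>) \<and>
       int (degree (R_poly p m k1 k2 k k')) = k \<and>
       (\<forall>X. X \<noteq> 0 \<longrightarrow>
          X ^ (nat k + 1) * poly (R_poly p m k1 k2 k k') (inverse X)
            = poly (R_poly p m k1 k2 k k') X)" if k1_nonneg: "0 \<le> k1" for s
  proof -
    obtain K1 K2 K where K: "k1 = int K1" "k2 = int K2" "k = int K"
      using k1_nonneg k12 k_ge by (metis add_nonneg_nonneg nonneg_int_cases order_trans)
    have le: "K1 \<le> K2" "K2 \<le> K1 + 1" "K1 + K2 \<le> K"
      using k12 k_ge by (simp_all add: K)
    have R: "R_poly p m k1 k2 k k' = R_poly p m (int K1) (int K2) (int K) (int K - int K1 - int K2)"
      by (simp add: K k')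
    define Z T where "Z = P ^ (2 * m) * Y s" and "T = P ^ (4 * m) * (Y s / P)"
    have int: "a $ i \<in> padic_Ints" "b $ i \<in> padic_Ints" for i
      using k1_nonneg integral by blast+
    have "P ^ r * C_coeff \<mu> \<psi> r (a, b) = of_bool (r \<le> K2) * P ^ (4 * m * r) +
      (\<Sum>j<r. of_bool (j \<le> K1) * P ^ ((r + j) * (2 * m) + m) *
        (P ^ (r - j) * of_bool (r + j \<le> K) - P ^ (r - j - 1) * of_bool (r + j - 1 \<le> K)))" for r
      using C_coeff_formula[OF psi mu int k1 k2 k, of r, folded p m P_def] unfolding K of_nat_le_iff .
    then have "(\<lambda>r. Y s ^ r * C_coeff \<mu> \<psi> r (a, b)) sums
      ((1 - Z / P) * (P ^ m * (\<Sum>j\<le>K1. T ^ j * (\<Sum>e=1..K - 2 * j. Z ^ e))) +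
      (\<Sum>r\<le>K2. T ^ r) - P ^ m * (Z / P) * (\<Sum>j\<le>K1. T ^ j))"
      unfolding Z_def T_def using P le by (intro sum_generating_function) auto
    moreover have "\<dots> = total s"
    proof -
      have Z: "P powr (2 * of_nat m - s) = Z" and Z1: "P powr (2 * of_nat m - s - 1) = Z / P"
        using powr_shift[of "2 * m" s] powr_shift1[of "2 * m" s] by (simp_all add: Z_def)
      have T: "P powr (4 * of_nat m - s - 1) = T"
        using powr_shift1[of "4 * m" s] by (simp add: T_def)
      have W: "P powr (3 * of_nat m - s - 1) = P ^ m * (Z / P)"
        using powr_shift1[of "3 * m" s] power_add[of P m "2 * m"] by (simp add: Z_def)
      have geometric: "(\<Sum>r = 0..int n. P powr (of_int r * (4 * of_nat m - s - 1))) = (\<Sum>r\<le>n. T ^ r)" for n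
        using sum_int_interval[of "\<lambda>r. P powr (of_int r * (4 * of_nat m - s - 1))" 0 n]
        by (simp add: powr_nat_mult T atLeast0AtMost)
      \<comment> \<open>This identity matches the double sum for \<open>R_poly\<close> with the one
        in the generating function.\<close>
      have "P ^ (2 * m - 1) * Z = T"
      proof -
        have "P ^ (2 * m - 1) = P ^ (2 * m) / P"
          using P m_pos by (simp add: power_diff)
        then show ?thesis
          using power_add[of P "2 * m" "2 * m"] by (simp add: Z_def T_def)
      qed
      then have "poly (R_poly p m k1 k2 k k') Z = P ^ m * (\<Sum>j\<le>K1. T ^ j * (\<Sum>e=1..K - 2 * j. Z ^ e))"
        using poly_R_poly_double_sum[OF p_gt_1 m_pos le, of Z] by (simp only: R P_def)
      then show ?thesis
        unfolding total_def P_def[symmetric] Z Z1 W K(1,2) geometric by (simp only: K(1,2))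
    qed
    ultimately have "C_term \<mu> \<psi> \<eta> s sums total s"
      by (simp only: ext[of "C_term \<mu> \<psi> \<eta> s", OF C_term])
    then show ?thesis
      using coeff_R_poly_Ints[OF p_gt_1 m_pos le] degree_R_poly[OF p_gt_1 m_pos le] R_poly_palindromic[OF p_gt_1 m_pos le]
      unfolding R unfolding K(3) nat_int of_nat_eq_iff by (intro conjI allI impI)
  qed
  have summable: "summable (C_term \<mu> \<psi> \<eta> s)" for s
  proof -
    consider "\<not> 0 \<le> k2" | "0 \<le> k2" "\<not> 0 \<le> k1" | "0 \<le> k1" by blast
    then show ?thesis
      by cases (rule sums_summable[OF not_dual], assumption, rule sums_summable[OF boundary], assumption+,
        rule sums_summable[OF main[THEN conjunct1]])
  qed
  have support: "0 \<le> k2" if "\<exists>s. (\<Sum>r. C_term \<mu> \<psi> \<eta> s r) \<noteq> 0"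
  proof (rule ccontr)
    assume "\<not> 0 \<le> k2"
    from sums_unique[OF not_dual[OF this], symmetric] that show False by simp
  qed
  have boundary_sum: "(\<Sum>r. C_term \<mu> \<psi> \<eta> s r) = 1" if "k2 = 0 \<and> k1 = -1" for s
    using that by (intro sums_unique[OF boundary, symmetric]) simp_all
  have main_sum: "(\<Sum>r. C_term \<mu> \<psi> \<eta> s r) = total s" if "0 \<le> k1" for s
    by (rule sums_unique[OF main[OF that, THEN conjunct1], symmetric])
  show ?thesis
    unfolding total_def[symmetric]
  proof (intro conjI)
    show "\<forall>s. summable (C_term \<mu> \<psi> \<eta> s)"
      by (intro allI summable)
    show "(\<exists>s. (\<Sum>r. C_term \<mu> \<psi> \<eta> s r) \<noteq> 0) \<longrightarrow> 0 \<le> k2"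
      by (intro impI support)
    show "k2 = 0 \<and> k1 = -1 \<longrightarrow> (\<forall>s. (\<Sum>r. C_term \<mu> \<psi> \<eta> s r) = 1)"
      by (intro impI allI boundary_sum)
    show "0 \<le> k1 \<and> k1 \<le> k2 \<longleftrightarrow> \<eta> \<in> lattice_L"
      using lattice k12(1) by simp
    show "0 \<le> k1 \<and> k1 \<le> k2 \<longrightarrow> (\<forall>s. (\<Sum>r. C_term \<mu> \<psi> \<eta> s r) = total s) \<and>
       (\<forall>i. coeff (R_poly p m k1 k2 k k') i \<in> \<int>) \<and>
       int (degree (R_poly p m k1 k2 k k')) = k \<and>
       (\<forall>X. X \<noteq> 0 \<longrightarrow>
          X ^ (nat k + 1) * poly (R_poly p m k1 k2 k k') (inverse X)
            = poly (R_poly p m k1 k2 k k') X)"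
    proof (rule impI, elim conjE, rule conjI)
      assume nonneg: "0 \<le> k1"
      show "\<forall>s. (\<Sum>r. C_term \<mu> \<psi> \<eta> s r) = total s"
        by (intro allI main_sum nonneg)
    qed (rule main[THEN conjunct2])
  qed
qed

end
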